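(* Let $\alpha,\beta\in\mathbb R$, $\delta\in\mathbb R\setminus\{0,-1,-2,\dots\}$, $x>0$ and $y\in\mathbb R$. Then, for either choice of the sign (upper signs together or lower signs together), $$H_4\Big(\alpha,\beta;\frac12,\delta;-x,y\Big)=\operatorname{Re}\left[(1\pm 2i\sqrt x)^{-\alpha}\;{}_2F_1\Big(\alpha,\beta;\delta;\frac{y}{1\pm 2i\sqrt x}\Big)\right],$$ and, for $\alpha\ne1$, $$H_4\Big(\alpha,\beta;\frac32,\delta;-x,y\Big)=\frac{\mp1}{2(\alpha-1)\sqrt x}\,\operatorname{Im}\left[(1\pm 2i\sqrt x)^{1-\alpha}\;{}_2F_1\Big(\alpha-1,\beta;\delta;\frac{y}{1\pm 2i\sqrt x}\Big)\right].$$
   Context: $(\lambda)_n=\lambda(\lambda+1)\cdots(\lambda+n-1)$, $(\lambda)_0=1$, is the Pochhammer symbol. The Horn function $H_4$ is defined by $$H_4(\alpha,\beta;\gamma,\delta;s,t)=\sum_{k\ge0}\sum_{n\ge0}\frac{(\alpha)_{2k+n}(\beta)_n}{(\gamma)_k(\delta)_n}\frac{s^k}{k!}\frac{t^n}{n!},\qquad 2\sqrt{|s|}+|t|<1,$$ and outside this convergence domain by analytic continuation; for the arguments $(s,t)=(-x,y)$ with $x>0$, $y\in\mathbb R$, this means the (unique) real-analytic continuation from $\{(x,y): x>0,\ 2\sqrt{x}+|y|<1\}$ to $(0,\infty)\times\mathbb R$. ${}_2F_1(a,b;c;z)=\sum_{n\ge0}\frac{(a)_n(b)_n}{(c)_n}\frac{z^n}{n!}$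 is the Gauss hypergeometric function, continued analytically to $\mathbb C\setminus[1,\infty)$ (principal branch). Complex powers are principal values. *)

theory Defs
  imports "HOL-Complex_Analysis.Complex_Analysis"
begin

(* Real-analyticity in two variables on an open set U: around every point of U the function is
   given on a small square by an (unconditionally convergent) double power series. The square
   need not lie in U, but as U is open it can be shrunk so that it does. *)
definition real_analytic2_on :: "(real \<Rightarrow> real \<Rightarrow> real) \<Rightarrow> (real \<times> real) set \<Rightarrow> bool" where
  "real_analytic2_on F U \<longleftrightarrow>
     (\<forall>(x0, y0)\<in>U. \<exists>r>0. \<exists>c :: nat \<Rightarrow> nat \<Rightarrow> real. \<forall>x y.
        \<bar>x - x0\<bar> < r \<longrightarrow> \<bar>y - y0\<bar> < r \<longrightarrow>
        ((\<lambda>(i, j). c i j * (x - x0) ^ i * (y - y0) ^ j) has_sum F x y) UNIV)"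

definition horn_H4_series :: "real \<Rightarrow> real \<Rightarrow> real \<Rightarrow> real \<Rightarrow> real \<Rightarrow> real \<Rightarrow> real" where
  "horn_H4_series \<alpha> \<beta> \<gamma> \<delta> s t =
     (\<Sum>k. \<Sum>n. pochhammer \<alpha> (2 * k + n) * pochhammer \<beta> n / (pochhammer \<gamma> k * pochhammer \<delta> n)
            * (s ^ k / fact k) * (t ^ n / fact n))"

(* F continues (x, y) \<mapsto> H4(\<alpha>, \<beta>; \<gamma>, \<delta>; -x, y) real-analytically to the half-plane x > 0. *)
definition horn_H4_continuation ::
  "real \<Rightarrow> real \<Rightarrow> real \<Rightarrow> real \<Rightarrow> (real \<Rightarrow> real \<Rightarrow> real) \<Rightarrow> bool" where
  "horn_H4_continuation \<alpha> \<beta> \<gamma> \<delta> F \<longleftrightarrow>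
     real_analytic2_on F ({0<..} \<times> UNIV) \<and>
     (\<forall>x>0. \<forall>y. 2 * sqrt x + \<bar>y\<bar> < 1 \<longrightarrow> F x y = horn_H4_series \<alpha> \<beta> \<gamma> \<delta> (- x) y)"

(* Meaningful on the convergence domain of the series and for s < 0; the value for s \<ge> 0 outside
   the convergence domain is junk. The continuation is only determined on x > 0, which is why the
   description operator is applied to its value at (-s, t) and not to F itself. *)
definition horn_H4 :: "real \<Rightarrow> real \<Rightarrow> real \<Rightarrow> real \<Rightarrow> real \<Rightarrow> real \<Rightarrow> real" where
  "horn_H4 \<alpha> \<beta> \<gamma> \<delta> s t =
     (if 2 * sqrt \<bar>s\<bar> + \<bar>t\<bar> < 1 then horn_H4_series \<alpha> \<beta> \<gamma> \<delta> s t
      else (THE w. \<exists>F. horn_H4_continuation \<alpha> \<beta> \<gamma> \<delta> F \<and> w = F (- s) t))"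

(* F is the principal branch of the Gauss function 2F1(a, b; c; .), i.e. the holomorphic
   continuation of its power series from the unit disc to the plane cut along [1, \<infinity>). *)
definition hyp2F1_continuation ::
  "complex \<Rightarrow> complex \<Rightarrow> complex \<Rightarrow> (complex \<Rightarrow> complex) \<Rightarrow> bool" where
  "hyp2F1_continuation a b c F \<longleftrightarrow>
     F holomorphic_on (- (complex_of_real ` {1..})) \<and>
     (\<forall>u. norm u < 1 \<longrightarrow> F u = eval_fps (fps_hypergeo [a, b] [c] 1) u)"

(* Junk for z on the cut [1, \<infinity>). *)
definition hyp2F1 :: "complex \<Rightarrow> complex \<Rightarrow> complex \<Rightarrow> complex \<Rightarrow> complex" where
  "hyp2F1 a b c z = (THE w. \<exists>F. hyp2F1_continuation a b c F \<and> w = F z)"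

lemma eval_fps_hypergeo_2_1:
  "eval_fps (fps_hypergeo [a, b] [c] 1) (z :: complex) =
     (\<Sum>n. pochhammer a n * pochhammer b n / pochhammer c n * (z ^ n / fact n))"
  by (simp add: eval_fps_def)

end

theory Submission
  imports Defs
begin

text \<open>Write \<open>\<xi> = 1 + 2 i \<sigma> \<surd>x\<close>, so that \<open>\<xi> = 1 + i \<tau>\<close> with real \<open>\<tau>\<close> and \<open>\<tau>\<^sup>2 = 4 x\<close>. Expanding
\<open>\<xi> powr (- a - n)\<close> by the binomial series turns \<open>\<xi> powr (- a) * 2F1(a, b; c; y / \<xi>)\<close> into the double
series with terms \<open>(a)\<^bsub>n+m\<^esub> (b)\<^bsub>n\<^esub> / ((c)\<^bsub>n\<^esub> n! m!) (- i \<tau>)^m y^n\<close> (lemma \<open>hypergeo_double_series\<close>).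
Its even powers of \<open>\<tau>\<close> are real and its odd ones imaginary. As \<open>(2 k)! = 4^k k! (1/2)\<^bsub>k\<^esub>\<close> and
\<open>(2 k + 1)! = 4^k k! (3/2)\<^bsub>k\<^esub>\<close>, the real part is the \<open>H4\<close> series with \<open>\<gamma> = 1/2\<close>, while the imaginary
part is, up to a factor, the one with \<open>\<gamma> = 3/2\<close>; there \<open>a = \<alpha> - 1\<close>, because
\<open>(\<alpha> - 1)\<^bsub>n+2k+1\<^esub> = (\<alpha> - 1) (\<alpha>)\<^bsub>n+2k\<^esub>\<close>. This settles the domain \<open>2 \<surd>x + |y| < 1\<close>.

Outside that domain both sides are analytic continuations, and three facts are needed. First, the
Gauss function has to extend to the plane cut along \<open>[1, \<infinity>)\<close> for all real \<open>b\<close> and all real \<open>c\<close>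
other than \<open>0, -1, -2, \<dots>\<close>: Euler's integral
does this if \<open>1 < b\<close> and \<open>b + 1 < c\<close>, and the general case is reduced to it by lowering \<open>c\<close>
with a first-order differential operator and by integrating
\<open>d/dz 2F1(a, b; c; z) = (a b / c) 2F1(a + 1, b + 1; c + 1; z)\<close> (lemma \<open>hyp2F1_continuation_exists\<close>).
Secondly, the right-hand sides are real-analytic for \<open>x > 0\<close>. Here \<open>y / \<xi>\<close> never meets the cut,
since \<open>\<xi>\<close> is not real; the function is therefore the real part of a holomorphic function of two
variables, which Cauchy's estimates expand into a double power series (lemma \<open>real_analytic2_on_Re\<close>).
Thirdly, the real-analytic continuation is unique (lemma \<open>horn_H4_continuation_unique\<close>).\<close>

section \<open>Growth of the hypergeometric coefficients\<close>

lemma ratio_tendsto_1_imp_bound: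
  fixes u \<rho> :: "nat \<Rightarrow> real"
  assumes nonneg: "\<And>n. 0 \<le> u n" and step: "\<And>n. u (Suc n) \<le> u n * \<rho> n"
    and lim: "\<rho> \<longlonglongrightarrow> 1" and q: "1 < q"
  obtains C where "0 < C" "\<And>n. u n \<le> C * q ^ n"
proof -
  obtain N where N: "\<And>n. n \<ge> N \<Longrightarrow> \<rho> n < q"
    using order_tendstoD(2)[OF lim q] by (auto simp: eventually_sequentially)
  define C where "C = 1 + (\<Sum>i\<le>N. u i)"
  have C: "0 < C" using nonneg by (auto simp: C_def intro!: add_pos_nonneg sum_nonneg)
  have "u n \<le> C * q ^ n" for n
  proof (induction n)
    case 0
    have "u 0 \<le> (\<Sum>i\<le>N. u i)"
      using nonneg by (intro member_le_sum) auto
    then show ?case by (simp add: C_def)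
  next
    case (Suc n)
    show ?case
    proof (cases "n \<ge> N")
      case True
      have "u (Suc n) \<le> u n * \<rho> n" by (rule step)
      also have "\<dots> \<le> u n * q" using N[OF True] nonneg by (intro mult_left_mono) auto
      also have "\<dots> \<le> (C * q ^ n) * q" using Suc q by (intro mult_right_mono) auto
      finally show ?thesis by (simp add: mult_ac)
    next
      case False
      have "u (Suc n) \<le> (\<Sum>i\<le>N. u i)"
        using nonneg False by (intro member_le_sum) auto
      also have "\<dots> \<le> C * 1" by (simp add: C_def)
      also have "\<dots> \<le> C * q ^ Suc n" using C q by (intro mult_left_mono one_le_power) auto
      finally show ?thesis .
    qed
  qed
  with C show ?thesis using that by blast
qed

text \<open>The quotient of consecutive terms is \<open>(b + n) / (c + n)\<close>, which tends to \<open>1\<close>. A bound on the terms is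
used in place of a ratio test with division, so that nothing goes wrong when \<open>b\<close> is a nonpositive
integer and the sequence eventually vanishes. With \<open>c = 1\<close> this also bounds \<open>(a)\<^bsub>n\<^esub> / n!\<close>.\<close>

lemma pochhammer_ratio_bound:
  fixes b c :: complex
  assumes c: "c \<notin> \<int>\<^sub>\<le>\<^sub>0" and q: "1 < q"
  obtains C where "0 < C" "\<And>n. norm (pochhammer b n / pochhammer c n) \<le> C * q ^ n"
proof -
  have nz: "c + of_nat n \<noteq> 0" for n
    using c by (metis add.commute minus_of_nat_in_nonpos_Ints eq_neg_iff_add_eq_0)
  have "(\<lambda>n. (b - c) / (c + of_nat n)) \<longlonglongrightarrow> 0"
    by (intro tendsto_divide_0[OF tendsto_const] tendsto_add_filterlim_at_infinity[OF tendsto_const]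
          tendsto_of_nat)
  then have "(\<lambda>n. norm (1 + (b - c) / (c + of_nat n))) \<longlonglongrightarrow> norm (1 + 0 :: complex)"
    by (intro tendsto_intros)
  then have lim: "(\<lambda>n. norm ((b + of_nat n) / (c + of_nat n))) \<longlonglongrightarrow> 1"
    using nz by (simp add: field_simps)
  show ?thesis
  proof (rule ratio_tendsto_1_imp_bound[OF _ _ lim q, of "\<lambda>n. norm (pochhammer b n / pochhammer c n)"])
    show "norm (pochhammer b (Suc n) / pochhammer c (Suc n))
        \<le> norm (pochhammer b n / pochhammer c n) * norm ((b + of_nat n) / (c + of_nat n))" for n
      by (simp add: pochhammer_Suc norm_mult norm_divide)
  qed (use that in auto)
qed

text \<open>The hypergeometric coefficients are a product of two ratios, each of which grows at most like \<open>q ^ n\<close>;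
the factor \<open>q * q\<close> is the total loss.\<close>

lemma exists_square_mult_less_1:
  fixes r :: real
  assumes "r < 1"
  obtains q where "1 < q" "q * q * r < 1"
proof -
  have "((\<lambda>q. q * q * r) \<longlongrightarrow> 1 * 1 * r) (at_right 1)" by (intro tendsto_intros)
  then have "\<forall>\<^sub>F q in at_right 1. q * q * r < 1"
    using assms by (intro order_tendstoD(2)) auto
  then have "\<forall>\<^sub>F q in at_right 1. q * q * r < 1 \<and> 1 < q"
    by (intro eventually_conj) (auto simp: eventually_at_right_less)
  with that show ?thesis
    by (metis (mono_tags, lifting) eventually_happens' trivial_limit_at_right_real)
qed

lemma one_le_fps_conv_radius_hypergeo:
  fixes a b c :: complex
  assumes c: "c \<notin> \<int>\<^sub>\<le>\<^sub>0"
  shows "1 \<le> fps_conv_radius (fps_hypergeo [a, b] [c] 1)"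
  unfolding fps_conv_radius_def
proof (rule conv_radius_geI_ex)
  fix r :: real assume r: "0 < r" "ereal r < 1"
  then have "r < 1" by (simp add: one_ereal_def)
  then obtain q where q: "1 < q" "q * q * r < 1" by (rule exists_square_mult_less_1)
  have one: "(1::complex) \<notin> \<int>\<^sub>\<le>\<^sub>0" by auto
  obtain C where C: "0 < C" "\<And>n. norm (pochhammer b n / pochhammer c n) \<le> C * q ^ n"
    using pochhammer_ratio_bound[OF c q(1)] by blast
  obtain D where D: "0 < D" "\<And>n. norm (pochhammer a n / pochhammer 1 n) \<le> D * q ^ n"
    using pochhammer_ratio_bound[OF one q(1)] by blast
  have "summable (\<lambda>n. fps_nth (fps_hypergeo [a, b] [c] 1) n * complex_of_real r ^ n)"
  proof (rule summable_comparison_test')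
    show "summable (\<lambda>n. D * C * (q * q * r) ^ n)"
      using q r by (intro summable_mult summable_geometric) auto
    fix n :: nat
    have "norm (fps_nth (fps_hypergeo [a, b] [c] 1) n * complex_of_real r ^ n)
        = norm (pochhammer a n / pochhammer 1 n) * norm (pochhammer b n / pochhammer c n) * r ^ n"
      using r by (simp add: norm_mult norm_divide norm_power flip: pochhammer_fact)
    also have "\<dots> \<le> (D * q ^ n) * (C * q ^ n) * r ^ n"
      using C D r q by (intro mult_right_mono mult_mono) auto
    also have "\<dots> = D * C * (q * q * r) ^ n" by (simp add: power_mult_distrib)
    finally show "norm (fps_nth (fps_hypergeo [a, b] [c] 1) n * complex_of_real r ^ n) \<le> D * C * (q * q * r) ^ n" .
  qed
  then show "\<exists>z. norm z = r \<and> summable (\<lambda>n. fps_nth (fps_hypergeo [a, b] [c] 1) n * z ^ n)"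
    using r by (intro exI[of _ "of_real r"]) auto
qed

lemma less_fps_conv_radius_hypergeo:
  fixes a b c z :: complex
  assumes "c \<notin> \<int>\<^sub>\<le>\<^sub>0" "norm z < 1"
  shows "ereal (norm z) < fps_conv_radius (fps_hypergeo [a, b] [c] 1)"
  using assms(2) one_le_fps_conv_radius_hypergeo[OF assms(1)]
  by (metis ereal_less(3) less_le_trans one_ereal_def)


section \<open>Analytic continuation of the Gauss function to the slit plane\<close>

abbreviation slit_plane :: "complex set" where
  "slit_plane \<equiv> - (complex_of_real ` {1..})"

lemma in_slit_plane_iff: "z \<in> slit_plane \<longleftrightarrow> 1 - z \<notin> \<real>\<^sub>\<le>\<^sub>0"
  by (auto simp: complex_nonpos_Reals_iff complex_eq_iff image_iff)

lemma open_slit_plane: "open slit_plane"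
proof -
  have "slit_plane = (\<lambda>z. 1 - z) -` (- \<real>\<^sub>\<le>\<^sub>0)" using in_slit_plane_iff by auto
  then show ?thesis by (auto intro!: open_vimage continuous_intros)
qed

lemma slit_plane_scale:
  assumes "z \<in> slit_plane" "0 \<le> t" "t \<le> 1"
  shows "of_real t * z \<in> slit_plane"
proof
  assume "of_real t * z \<in> complex_of_real ` {1..}"
  then obtain s where s: "of_real t * z = of_real s" "1 \<le> s" by auto
  then have "t \<noteq> 0" by auto
  with s have "z = of_real (s / t)" by (simp add: field_simps)
  moreover have "1 \<le> s / t" using s assms \<open>t \<noteq> 0\<close> by (auto simp: field_simps)
  ultimately show False using assms(1) by (metis ComplD atLeast_iff image_eqI)
qed

lemma starlike_slit_plane: "starlike slit_plane"
proof -
  have "closed_segment 0 z \<subseteq> slit_plane" if z: "z \<in> slit_plane" for z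
  proof
    fix v assume "v \<in> closed_segment 0 z"
    then obtain u where "v = of_real u * z" "0 \<le> u" "u \<le> 1"
      by (auto simp: closed_segment_def scaleR_conv_of_real)
    then show "v \<in> slit_plane" using slit_plane_scale[OF z, of u] by simp
  qed
  moreover have "0 \<in> slit_plane" by (auto simp: image_iff)
  ultimately show ?thesis unfolding starlike_def by blast
qed

lemma ball_subset_slit_plane: "ball 0 1 \<subseteq> slit_plane"
  by auto

text \<open>The slit plane is connected, so by the identity theorem the description operator in \<open>hyp2F1\<close> picks
the value of any continuation that is at hand.\<close>

lemma hyp2F1_eqI:
  assumes F: "hyp2F1_continuation a b c F" and z: "z \<in> slit_plane"
  shows "hyp2F1 a b c z = F z"
  unfolding hyp2F1_def
proof (rule the_equality)
  show "\<exists>F'. hyp2F1_continuation a b c F' \<and> F z = F' z" using F by blast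
  fix w assume "\<exists>G. hyp2F1_continuation a b c G \<and> w = G z"
  then obtain G where G: "hyp2F1_continuation a b c G" "w = G z" by blast
  have "G z = F z"
  proof (rule analytic_continuation_open[where s = "ball 0 1" and s' = slit_plane and f = G and g = F])
    show "G holomorphic_on slit_plane" "F holomorphic_on slit_plane"
      using F G by (auto simp: hyp2F1_continuation_def)
    show "G u = F u" if "u \<in> ball 0 1" for u
      using F G that by (auto simp: hyp2F1_continuation_def)
  qed (use z open_slit_plane starlike_imp_connected[OF starlike_slit_plane] in auto)
  with G show "w = F z" by simp
qed

text \<open>Since \<open>c (c + 1)\<^bsub>n\<^esub> = (c)\<^bsub>n\<^esub> (c + n)\<close>, the operator \<open>1 + (1 / c) z d/dz\<close> maps the series with
parameter \<open>c + 1\<close> to the one with parameter \<open>c\<close>.\<close>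

lemma hyp2F1_continuation_lower:
  fixes a b c :: complex
  assumes c: "c \<notin> \<int>\<^sub>\<le>\<^sub>0" and G: "hyp2F1_continuation a b (c + 1) G"
  shows "\<exists>F. hyp2F1_continuation a b c F"
proof
  have c1: "c + 1 \<notin> \<int>\<^sub>\<le>\<^sub>0" using c plus_one_in_nonpos_Ints_imp by blast
  have c0: "c \<noteq> 0" using c by auto
  define g where "g = fps_hypergeo [a, b] [c + 1] (1::complex)"
  have Gh: "G holomorphic_on slit_plane" using G by (simp add: hyp2F1_continuation_def)
  show "hyp2F1_continuation a b c (\<lambda>z. G z + 1 / c * (z * deriv G z))"
    unfolding hyp2F1_continuation_def
  proof (intro conjI allI impI)
    show "(\<lambda>z. G z + 1 / c * (z * deriv G z)) holomorphic_on slit_plane"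
      using Gh open_slit_plane c0 by (intro holomorphic_intros) auto
    fix u :: complex assume u: "norm u < 1"
    then have ur: "ereal (norm u) < fps_conv_radius g"
      unfolding g_def by (rule less_fps_conv_radius_hypergeo[OF c1])
    have dg: "ereal (norm u) < fps_conv_radius (fps_deriv g)"
      using ur by (metis fps_conv_radius_deriv order_less_le_trans)
    have "deriv G u = deriv (eval_fps g) u"
    proof (rule deriv_cong_ev)
      have "\<forall>\<^sub>F v in nhds u. v \<in> ball 0 1" using u by (intro eventually_nhds_in_open) auto
      then show "\<forall>\<^sub>F v in nhds u. G v = eval_fps g v"
        by eventually_elim (use G in \<open>auto simp: hyp2F1_continuation_def g_def\<close>)
    qed simp
    also have "\<dots> = eval_fps (fps_deriv g) u"
      by (rule eval_fps_deriv[symmetric]) (rule ur)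
    finally have dG: "deriv G u = eval_fps (fps_deriv g) u" .
    have id: "fps_hypergeo [a, b] [c] 1 = g + fps_const (1 / c) * (fps_X * fps_deriv g)"
    proof (rule fps_ext)
      fix n
      have "(c + of_nat n) * pochhammer c n = c * pochhammer (c + 1) n"
        using pochhammer_rec[of c n] pochhammer_rec'[of c n] by (simp add: mult_ac)
      moreover have "pochhammer c n \<noteq> 0" "pochhammer (c + 1) n \<noteq> 0"
        using c c1 by (auto simp: pochhammer_eq_0_iff)
      ultimately have "1 / pochhammer c n = (1 + of_nat n / c) / pochhammer (c + 1) n"
        using c0 by (simp add: field_simps)
      then have "pochhammer a n * pochhammer b n / fact n * (1 / pochhammer c n) =
        pochhammer a n * pochhammer b n / fact n * ((1 + of_nat n / c) / pochhammer (c + 1) n)"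
        by (rule arg_cong)
      moreover have "fps_nth (fps_X * fps_deriv g) n = of_nat n * fps_nth g n"
        by (cases n) (auto)
      ultimately show "fps_nth (fps_hypergeo [a, b] [c] 1) n
          = fps_nth (g + fps_const (1 / c) * (fps_X * fps_deriv g)) n"
        by (simp add: g_def algebra_simps add_divide_distrib)
    qed
    have Xd: "ereal (norm u) < fps_conv_radius (fps_X * fps_deriv g)"
      using dg by (intro less_le_trans[OF _ fps_conv_radius_mult]) auto
    have cXd: "ereal (norm u) < fps_conv_radius (fps_const (1 / c) * (fps_X * fps_deriv g))"
      using Xd by (intro less_le_trans[OF _ fps_conv_radius_mult]) auto
    have "eval_fps (fps_hypergeo [a, b] [c] 1) u = eval_fps g u + 1 / c * (u * eval_fps (fps_deriv g) u)"
      unfolding id using ur dg Xd cXd by (simp add: eval_fps_add eval_fps_mult)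
    then show "G u + 1 / c * (u * deriv G u) = eval_fps (fps_hypergeo [a, b] [c] 1) u"
      using G u by (simp add: dG hyp2F1_continuation_def g_def)
  qed
qed

text \<open>The derivative of \<open>2F1(a, b; c; z)\<close> is \<open>(a b / c) 2F1(a + 1, b + 1; c + 1; z)\<close>, and on the starlike slit
plane every holomorphic function has a primitive. This lowers all three parameters at once and
makes it possible to start from a large \<open>b\<close>.\<close>

lemma hyp2F1_continuation_integrate:
  fixes a b c :: complex
  assumes c: "c \<notin> \<int>\<^sub>\<le>\<^sub>0" and G: "hyp2F1_continuation (a + 1) (b + 1) (c + 1) G"
  shows "\<exists>F. hyp2F1_continuation a b c F"
proof -
  have c1: "c + 1 \<notin> \<int>\<^sub>\<le>\<^sub>0" using c plus_one_in_nonpos_Ints_imp by blast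
  have c0: "c \<noteq> 0" using c by auto
  define f where "f = fps_hypergeo [a, b] [c] (1::complex)"
  define g where "g = fps_hypergeo [a + 1, b + 1] [c + 1] (1::complex)"
  have Gh: "G holomorphic_on slit_plane" using G by (simp add: hyp2F1_continuation_def)
  obtain P where P: "\<And>z. z \<in> slit_plane \<Longrightarrow> (P has_field_derivative G z) (at z)"
    using holomorphic_starlike_primitive[OF _ starlike_slit_plane open_slit_plane, of G "{}"] Gh
    by (metis Diff_empty finite.emptyI holomorphic_on_imp_continuous_on
        holomorphic_on_imp_differentiable_at open_slit_plane)
  define F where "F = (\<lambda>z. 1 + a * b / c * (P z - P 0))"
  have F': "(F has_field_derivative a * b / c * G z) (at z)" if "z \<in> slit_plane" for z
    unfolding F_def by (rule derivative_eq_intros P that refl | simp)+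
  have id: "fps_deriv f = fps_const (a * b / c) * g"
  proof (rule fps_ext)
    fix n
    have "(1 + of_nat n :: complex) \<noteq> 0" by (metis of_nat_Suc of_nat_neq_0)
    moreover have "fact n + of_nat n * fact n = (1 + of_nat n) * (fact n :: complex)"
      by (simp add: algebra_simps)
    ultimately show "fps_nth (fps_deriv f) n = fps_nth (fps_const (a * b / c) * g) n"
      by (simp add: f_def g_def pochhammer_rec add_ac)
  qed
  have less: "ereal (norm u) < fps_conv_radius f" "ereal (norm u) < fps_conv_radius g" if "norm u < 1" for u :: complex
    unfolding f_def g_def using c c1 that by (auto intro: less_fps_conv_radius_hypergeo)
  have "F u = eval_fps f u" if u: "norm u < 1" for u
  proof -
    have "\<exists>k. \<forall>x\<in>ball 0 1. F x - eval_fps f x = k"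
    proof (rule has_field_derivative_zero_constant)
      fix v :: complex assume v: "v \<in> ball 0 1"
      then have v': "v \<in> slit_plane" "norm v < 1" using ball_subset_slit_plane by auto
      have "(eval_fps f has_field_derivative eval_fps (fps_deriv f) v) (at v)"
        using less v' by (intro has_field_derivative_eval_fps) auto
      also have "eval_fps (fps_deriv f) v = a * b / c * G v"
        unfolding id using less v' G by (subst eval_fps_mult) (auto simp: hyp2F1_continuation_def g_def)
      finally have "((\<lambda>x. F x - eval_fps f x) has_field_derivative a * b / c * G v - a * b / c * G v) (at v)"
        using F'[OF v'(1)] by (intro DERIV_diff)
      then show "((\<lambda>x. F x - eval_fps f x) has_field_derivative 0) (at v within ball 0 1)"
        by (simp add: has_field_derivative_at_within)
    qed auto
    then obtain k where k: "\<And>x. x \<in> ball 0 1 \<Longrightarrow> F x - eval_fps f x = k" by blast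
    have "k = 0" using k[of 0] by (simp add: F_def f_def eval_fps_at_0)
    with k[of u] u show ?thesis by simp
  qed
  moreover have "F holomorphic_on slit_plane"
    using F' open_slit_plane by (subst holomorphic_on_open) auto
  ultimately show ?thesis by (auto simp: hyp2F1_continuation_def f_def)
qed

lemma continuous_on_powr_const:
  fixes f :: "'a :: topological_space \<Rightarrow> complex"
  assumes "continuous_on A f" and "\<And>x. x \<in> A \<Longrightarrow> f x \<notin> \<real>\<^sub>\<le>\<^sub>0"
  shows "continuous_on A (\<lambda>x. f x powr c)"
proof -
  have "f x \<noteq> 0" if "x \<in> A" for x using assms(2)[OF that] by auto
  then have "continuous_on A (\<lambda>x. exp (c * Ln (f x)))"
    by (intro continuous_intros assms) auto
  then show ?thesis
    using \<open>\<And>x. x \<in> A \<Longrightarrow> f x \<noteq> 0\<close>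
    by (subst continuous_on_cong[OF refl, of _ _ "\<lambda>x. exp (c * Ln (f x))"]) (auto simp: powr_def)
qed

text \<open>Euler's integral of \<open>t powr (b - 1) * (1 - t) powr (c - b - 1) * (1 - t z) powr (- a)\<close> over \<open>[0, 1]\<close>.
The hypotheses make both exponents positive, so that the integrand is continuous on the closed
interval; this restriction costs nothing, as the parameters are shifted afterwards.\<close>

lemma hyp2F1_continuation_euler:
  fixes a :: complex and b c :: real
  assumes b: "1 < b" and c: "b + 1 < c"
  shows "\<exists>F. hyp2F1_continuation a (of_real b) (of_real c) F"
proof -
  define w where "w = (\<lambda>t. t powr (b - 1) * (1 - t) powr (c - b - 1))"
  have w_cont: "continuous_on A w" if "A \<subseteq> {0..1}" for A
  proof (rule continuous_on_subset[OF _ that])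
    show "continuous_on {0..1} w"
      unfolding w_def using b c
      by (intro continuous_on_mult continuous_on_powr' continuous_on_diff
            continuous_on_id continuous_on_const) auto
  qed
  define E where "E = (\<lambda>z. integral {0..1} (\<lambda>t. of_real (w t) * (1 - of_real t * z) powr (- a)))"
  have nonneg: "1 - of_real t * z \<notin> \<real>\<^sub>\<le>\<^sub>0" if "z \<in> slit_plane" "t \<in> {0..1}" for z t
    using slit_plane_scale[OF that(1), of t] that(2) in_slit_plane_iff by auto
  have E_hol: "E holomorphic_on slit_plane"
  proof -
    have "E holomorphic_on ball z0 r" if sub: "ball z0 r \<subseteq> slit_plane" for z0 r
      unfolding E_def
    proof (rule leibniz_rule_holomorphic[where a = "0::real" and b = 1, unfolded box_real(2)])
      fix z t assume zt: "z \<in> ball z0 r" "t \<in> {0..1::real}"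
      then have z: "z \<in> slit_plane" using sub by auto
      show "((\<lambda>z. of_real (w t) * (1 - of_real t * z) powr (- a)) has_field_derivative
         of_real (w t) * (of_real t * a * (1 - of_real t * z) powr (- a - 1))) (at z within ball z0 r)"
        using nonneg[OF z zt(2)] by (auto intro!: derivative_eq_intros)
    next
      fix z assume "z \<in> ball z0 r"
      then have z: "z \<in> slit_plane" using sub by auto
      show "(\<lambda>t. of_real (w t) * (1 - of_real t * z) powr (- a)) integrable_on {0..1}"
        using nonneg[OF z]
        by (intro integrable_continuous_interval continuous_on_mult continuous_on_of_real w_cont
              continuous_on_powr_const continuous_on_diff continuous_on_const continuous_on_id) auto
    next
      have "continuous_on (ball z0 r \<times> {0..1::real}) (\<lambda>p. complex_of_real (w (snd p)) *
          (of_real (snd p) * a * (1 - of_real (snd p) * fst p) powr (- a - 1)))"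
        using nonneg sub
        by (intro continuous_on_mult continuous_on_of_real continuous_on_powr_const
              continuous_on_diff continuous_on_const continuous_on_snd continuous_on_fst
              continuous_on_id continuous_on_compose2[OF w_cont[OF order_refl]]) auto
      then show "continuous_on (ball z0 r \<times> {0..1::real}) (\<lambda>(z, t). complex_of_real (w t) *
          (of_real t * a * (1 - of_real t * z) powr (- a - 1)))"
        by (simp add: case_prod_unfold)
    qed auto
    then have "E field_differentiable at z" if "z \<in> slit_plane" for z
      using that open_slit_plane
      by (meson centre_in_ball holomorphic_on_imp_differentiable_at open_ball openE)
    then show ?thesis
      by (auto simp: holomorphic_on_def field_differentiable_at_within)
  qed
  \<comment> \<open>In the unit disc the binomial series is integrated termwise; each term gives a Beta integral.\<close>
  have E_eq: "E z = of_real (Beta b (c - b)) * eval_fps (fps_hypergeo [a, of_real b] [of_real c] 1) z"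
    if z: "norm z < 1" for z
  proof -
    define s where "s = (\<lambda>n t. of_real (w t) * (pochhammer a n / fact n * (of_real t * z) ^ n))"
    have s_int: "(s n has_integral pochhammer a n / fact n * z ^ n * of_real (Beta (b + n) (c - b))) {0..1}" for n
    proof -
      have "((\<lambda>t. t powr (b + n - 1) * (1 - t) powr (c - b - 1)) has_integral Beta (b + n) (c - b)) {0..1}"
        using b c by (intro has_integral_Beta_real) auto
      then have "((\<lambda>t. w t * t ^ n) has_integral Beta (b + n) (c - b)) {0..1}"
      proof (rule has_integral_eq[rotated])
        fix t :: real assume "t \<in> {0..1}"
        then show "t powr (b + n - 1) * (1 - t) powr (c - b - 1) = w t * t ^ n"
          using b by (cases "t = 0") (auto simp: w_def powr_add powr_diff powr_realpow)
      qed
      then have "((\<lambda>t. pochhammer a n / fact n * z ^ n * of_real (w t * t ^ n)) has_integral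
           pochhammer a n / fact n * z ^ n * of_real (Beta (b + n) (c - b))) {0..1}"
        by (intro has_integral_mult_right has_integral_of_real)
      then show ?thesis by (rule has_integral_eq[rotated]) (simp add: s_def power_mult_distrib)
    qed
    have binom: "pochhammer a n / fact n = (-1) ^ n * ((- a) gchoose n)" for n
      by (simp add: gbinomial_pochhammer flip: power_mult_distrib)
    have s_sums: "(\<lambda>n. s n t) sums (of_real (w t) * (1 - of_real t * z) powr (- a))" if "t \<in> {0..1}" for t
    proof -
      have "norm (of_real t * z) \<le> 1 * norm z"
        using that unfolding norm_mult by (intro mult_right_mono) auto
      then have "(\<lambda>n. ((- a) gchoose n) * (- (of_real t * z)) ^ n) sums (1 + - (of_real t * z)) powr (- a)"
        using z by (intro gen_binomial_complex) auto
      then have "(\<lambda>n. pochhammer a n / fact n * (of_real t * z) ^ n) sums (1 - of_real t * z) powr (- a)"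
        unfolding power_minus[of "of_real t * z"] binom by (simp add: mult_ac)
      then show ?thesis unfolding s_def by (rule sums_mult)
    qed
    have "compact (w ` {0..1})" by (intro compact_continuous_image w_cont) auto
    then obtain M where M: "\<And>t. t \<in> {0..1} \<Longrightarrow> norm (w t) \<le> M"
      using compact_imp_bounded by (force simp: bounded_iff)
    have M0: "0 \<le> M" using M[of 0] by (simp add: w_def)
    have "uniform_limit {0..1} (\<lambda>N t. \<Sum>n<N. s n t)
        (\<lambda>t. of_real (w t) * (1 - of_real t * z) powr (- a)) sequentially"
    proof -
      have "uniform_limit {0..1} (\<lambda>N t. \<Sum>n<N. s n t) (\<lambda>t. \<Sum>n. s n t) sequentially"
      proof (rule Weierstrass_m_test)
        show "summable (\<lambda>n. M * norm (pochhammer a n / fact n * z ^ n))"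
        proof (rule summable_mult)
          have "summable (\<lambda>n. norm (((- a) gchoose n) * z ^ n))"
          \<comment> \<open>The radius of convergence of the binomial series is \<open>1\<close> only if the series does not terminate.\<close>
          proof (cases "a \<in> \<int>\<^sub>\<le>\<^sub>0")
            case True
            then obtain k where k: "- a = of_nat k" by (auto elim!: nonpos_Ints_cases')
            show ?thesis
              by (rule summable_finite[of "{..k}"]) (auto simp: k binomial_gbinomial[symmetric] binomial_eq_0)
          next
            case False
            then have "- a \<notin> \<nat>" by (auto elim!: Nats_cases simp: minus_equation_iff[of a])
            then show ?thesis using z
              by (intro abs_summable_in_conv_radius) (simp add: conv_radius_gchoose one_ereal_def)
          qed
          then show "summable (\<lambda>n. norm (pochhammer a n / fact n * z ^ n))"
            unfolding binom by (simp add: norm_mult norm_power)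
        qed
        fix n and t :: real assume t: "t \<in> {0..1}"
        have "norm (s n t) = norm (w t) * (norm (pochhammer a n / fact n * z ^ n) * t ^ n)"
          using t by (simp add: s_def norm_mult norm_divide norm_power power_mult_distrib)
        also have "\<dots> \<le> M * (norm (pochhammer a n / fact n * z ^ n) * 1)"
          using M[OF t] M0 t by (intro mult_mono mult_left_mono power_le_one) auto
        finally show "norm (s n t) \<le> M * norm (pochhammer a n / fact n * z ^ n)" by simp
      qed
      then show ?thesis
        by (rule uniform_limit_cong'[THEN iffD1, rotated -1]) (use s_sums in \<open>auto simp: sums_iff\<close>)
    qed
    then obtain I J where IJ: "\<And>N. ((\<lambda>t. \<Sum>n<N. s n t) has_integral I N) {0..1}"
        "((\<lambda>t. of_real (w t) * (1 - of_real t * z) powr (- a)) has_integral J) {0..1}" "I \<longlonglongrightarrow> J"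
    proof (rule uniform_limit_integral)
      show "continuous_on {0..1} (\<lambda>t. \<Sum>n<N. s n t)" for N
        unfolding s_def by (intro continuous_intros w_cont) auto
    qed auto
    have "I = (\<lambda>N. \<Sum>n<N. pochhammer a n / fact n * z ^ n * of_real (Beta (b + n) (c - b)))"
    proof
      show "I N = (\<Sum>n<N. pochhammer a n / fact n * z ^ n * of_real (Beta (b + n) (c - b)))" for N
        using IJ(1)[of N] has_integral_sum[of "{..<N}" s, OF _ s_int] has_integral_unique by blast
    qed
    with IJ(3) have "(\<lambda>n. pochhammer a n / fact n * z ^ n * of_real (Beta (b + n) (c - b))) sums J"
      unfolding sums_def by simp
    also have "(\<lambda>n. pochhammer a n / fact n * z ^ n * complex_of_real (Beta (b + n) (c - b))) =
        (\<lambda>n. of_real (Beta b (c - b)) * (fps_nth (fps_hypergeo [a, of_real b] [of_real c] 1) n * z ^ n))"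
    proof
      fix n :: nat
      have "b \<notin> \<int>\<^sub>\<le>\<^sub>0" "c \<notin> \<int>\<^sub>\<le>\<^sub>0" "c + n \<notin> \<int>\<^sub>\<le>\<^sub>0"
          "b + n \<notin> \<int>\<^sub>\<le>\<^sub>0"
        using b c by (auto elim!: nonpos_Ints_cases)
      then have "Gamma b \<noteq> 0" "Gamma c \<noteq> 0" "Gamma (b + n) = pochhammer b n * Gamma b"
          "Gamma (c + n) = pochhammer c n * Gamma c" "pochhammer c n \<noteq> 0"
        by (auto simp: pochhammer_Gamma Gamma_eq_zero_iff pochhammer_eq_0_iff)
      then have "Beta (b + n) (c - b) = Beta b (c - b) * (pochhammer b n / pochhammer c n)"
        by (simp add: Beta_def field_simps)
      then show "pochhammer a n / fact n * z ^ n * complex_of_real (Beta (b + n) (c - b)) =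
         of_real (Beta b (c - b)) * (fps_nth (fps_hypergeo [a, of_real b] [of_real c] 1) n * z ^ n)"
        by (simp add: pochhammer_of_real mult_ac)
    qed
    finally have "(\<lambda>n. of_real (Beta b (c - b)) * (fps_nth (fps_hypergeo [a, of_real b] [of_real c] 1) n * z ^ n)) sums E z"
      using IJ(2) by (simp add: E_def integral_unique)
    moreover have "complex_of_real c \<notin> \<int>\<^sub>\<le>\<^sub>0"
      unfolding of_real_in_nonpos_Ints_iff using b c by (auto elim!: nonpos_Ints_cases)
    then have "ereal (norm z) < fps_conv_radius (fps_hypergeo [a, of_real b] [complex_of_real c] 1)"
      using z by (intro less_fps_conv_radius_hypergeo)
    ultimately show ?thesis
      using sums_mult[OF sums_eval_fps] sums_unique2 by blast
  qed
  have "Beta b (c - b) \<noteq> 0"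
    using b c by (auto simp: Beta_def Gamma_eq_zero_iff elim!: nonpos_Ints_cases)
  then have "hyp2F1_continuation a (of_real b) (of_real c) (\<lambda>z. E z / of_real (Beta b (c - b)))"
    unfolding hyp2F1_continuation_def using E_eq by (auto intro!: holomorphic_intros E_hol)
  then show ?thesis by blast
qed

text \<open>Shifting all parameters by \<open>n\<close> makes \<open>b + n > 1\<close>; a further shift of \<open>c\<close> alone by \<open>m\<close> makes it exceed
\<open>b + 1\<close>. Both shifts are undone by the two reduction steps.\<close>

theorem hyp2F1_continuation_exists:
  fixes a :: complex and b c :: real
  assumes c: "c \<notin> \<int>\<^sub>\<le>\<^sub>0"
  shows "\<exists>F. hyp2F1_continuation a (of_real b) (of_real c) F"
proof -
  have shift: "x + real n \<notin> \<int>\<^sub>\<le>\<^sub>0" if "x \<notin> \<int>\<^sub>\<le>\<^sub>0" for x n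
  proof (induction n)
    case (Suc n)
    then show ?case using plus_one_in_nonpos_Ints_imp[of "x + real n"] by (auto simp: add_ac)
  qed (use that in simp)
  have lower: "\<exists>F. hyp2F1_continuation a (of_real b) (of_real c) F"
    if "c \<notin> \<int>\<^sub>\<le>\<^sub>0" "\<exists>F. hyp2F1_continuation a (of_real b) (of_real (c + real n)) F" for a b c n
    using that
  proof (induction n arbitrary: c)
    case (Suc n)
    have "c + 1 \<notin> \<int>\<^sub>\<le>\<^sub>0" using shift[of c 1] Suc.prems by simp
    moreover have "c + real (Suc n) = c + 1 + real n" by simp
    ultimately have "\<exists>F. hyp2F1_continuation a (of_real b) (of_real (c + 1)) F"
      using Suc.IH Suc.prems(2) by metis
    then show ?case
      using hyp2F1_continuation_lower[of "of_real c" a "of_real b"] Suc.prems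
      by (auto simp: of_real_in_nonpos_Ints_iff)
  qed simp
  obtain n where n: "1 - b < real n" using reals_Archimedean2 by blast
  obtain m where m: "b + 1 - c < real m" using reals_Archimedean2 by blast
  have "\<exists>F. hyp2F1_continuation (a + of_nat n) (of_real (b + real n)) (of_real (c + real n)) F"
  proof (rule lower[of _ _ _ m])
    show "c + real n \<notin> \<int>\<^sub>\<le>\<^sub>0" using c by (rule shift)
    show "\<exists>F. hyp2F1_continuation (a + of_nat n) (of_real (b + real n)) (of_real (c + real n + real m)) F"
      using n m by (intro hyp2F1_continuation_euler) auto
  qed
  then show ?thesis using c
  proof (induction n arbitrary: a b c)
    case (Suc n)
    have "c + 1 \<notin> \<int>\<^sub>\<le>\<^sub>0" using shift[of c 1] Suc.prems by simp
    moreover have "c + real (Suc n) = c + 1 + real n" "b + real (Suc n) = b + 1 + real n"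
        "a + of_nat (Suc n) = a + 1 + of_nat n" by simp_all
    ultimately have "\<exists>F. hyp2F1_continuation (a + 1) (of_real (b + 1)) (of_real (c + 1)) F"
      using Suc.IH Suc.prems(1) by metis
    then show ?case
      using hyp2F1_continuation_integrate[of "of_real c" a "of_real b"] Suc.prems
      by (auto simp: of_real_in_nonpos_Ints_iff)
  qed simp
qed

section \<open>Uniqueness of the real-analytic continuation\<close>

text \<open>Uniqueness in two variables is obtained on horizontal and vertical lines, so only the
one-variable notion needs an identity theorem.\<close>

definition real_analytic1_on :: "(real \<Rightarrow> real) \<Rightarrow> real set \<Rightarrow> bool" where
  "real_analytic1_on f I \<longleftrightarrow>
     (\<forall>t0\<in>I. \<exists>r>0. \<exists>a. \<forall>t. \<bar>t - t0\<bar> < r \<longrightarrow> (\<lambda>n. a n * (t - t0) ^ n) sums f t)"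

text \<open>The series converges in the complex disc of the same radius, where the identity theorem for
holomorphic functions applies: \<open>U\<close> accumulates at each of its points.\<close>

lemma real_power_series_eq_0:
  fixes a :: "nat \<Rightarrow> real"
  assumes sums: "\<And>t. \<bar>t - t0\<bar> < r \<Longrightarrow> (\<lambda>n. a n * (t - t0) ^ n) sums f t"
    and U: "open U" "U \<noteq> {}" "U \<subseteq> {t. \<bar>t - t0\<bar> < r}" and zero: "\<And>t. t \<in> U \<Longrightarrow> f t = 0"
    and t: "\<bar>t - t0\<bar> < r"
  shows "f t = 0"
proof -
  obtain u where u: "u \<in> U" using U by blast
  define g where "g = (\<lambda>z. \<Sum>n. complex_of_real (a n) * (z - of_real t0) ^ n)"
  have g_sums: "(\<lambda>n. complex_of_real (a n) * (z - of_real t0) ^ n) sums g z"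
    if z: "z \<in> ball (of_real t0) r" for z
  proof -
    have nz: "dist (of_real t0) z < r" using z by auto
    obtain s where s: "dist (of_real t0) z < s" "s < r" using nz dense by blast
    have "summable (\<lambda>n. complex_of_real (a n) * of_real s ^ n)"
      using sums[of "t0 + s"] s zero_le_dist[of "of_real t0" z]
      by (auto simp: sums_iff summable_of_real_iff simp flip: of_real_power of_real_mult)
    then have "summable (\<lambda>n. complex_of_real (a n) * (z - of_real t0) ^ n)"
      by (rule powser_inside)
         (use s zero_le_dist[of "of_real t0" z] in \<open>auto simp: dist_norm norm_minus_commute\<close>)
    then show ?thesis unfolding g_def by (rule summable_sums)
  qed
  have g_hol: "g holomorphic_on ball (of_real t0) r" by (rule power_series_holomorphic[OF g_sums])
  have g_eq: "g (of_real s) = of_real (f s)" if s: "\<bar>s - t0\<bar> < r" for s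
  proof -
    have "dist (complex_of_real t0) (of_real s) < r"
      using s by (simp add: dist_of_real dist_real_def abs_minus_commute)
    then have "(\<lambda>n. complex_of_real (a n) * (of_real s - of_real t0) ^ n) sums g (of_real s)"
      using g_sums by auto
    moreover have "(\<lambda>n. complex_of_real (a n * (s - t0) ^ n)) sums of_real (f s)"
      using sums[OF s] by (simp only: sums_of_real_iff)
    ultimately show ?thesis by (simp add: sums_unique2)
  qed
  have "g (of_real t) = 0"
  proof (rule analytic_continuation[OF g_hol, where U = "of_real ` U" and \<xi> = "of_real u"])
    show "complex_of_real ` U \<subseteq> ball (of_real t0) r"
      using U by (auto simp: dist_of_real dist_real_def abs_minus_commute)
    show "complex_of_real u islimpt complex_of_real ` U"
      unfolding islimpt_approachable
    proof (intro allI impI)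
      fix e :: real assume "0 < e"
      moreover have "u islimpt U" using U u by (metis interior_open interior_limit_point)
      ultimately obtain v where "v \<in> U" "v \<noteq> u" "dist v u < e" by (auto simp: islimpt_approachable)
      then show "\<exists>x'\<in>complex_of_real ` U. x' \<noteq> of_real u \<and> dist x' (of_real u) < e"
        by (auto simp: dist_of_real)
    qed
    show "complex_of_real u \<in> ball (of_real t0) r" "of_real t \<in> ball (complex_of_real t0) r"
      using U u t by (auto simp: dist_of_real dist_real_def abs_minus_commute)
    show "g z = 0" if "z \<in> of_real ` U" for z using that U zero g_eq by auto
  qed auto
  with g_eq[OF t] show ?thesis by simp
qed

text \<open>The interior \<open>Z\<close> of the zero set is relatively closed: if a point of \<open>I\<close> is a limit of points of \<open>Z\<close>,
its convergence interval meets \<open>Z\<close> in an open set, and the preceding lemma kills the whole series.\<close>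

lemma real_analytic1_identity:
  assumes f: "real_analytic1_on f I" and I: "connected I"
    and U: "open U" "U \<noteq> {}" "U \<subseteq> I" "\<And>t. t \<in> U \<Longrightarrow> f t = 0" and t: "t \<in> I"
  shows "f t = 0"
proof -
  define Z where "Z = {s. \<exists>V. open V \<and> s \<in> V \<and> (\<forall>v\<in>V. f v = 0)}"
  have "open Z"
  proof (subst open_subopen, intro ballI)
    fix s assume "s \<in> Z"
    then obtain V where "open V" "s \<in> V" "\<forall>v\<in>V. f v = 0" by (auto simp: Z_def)
    then show "\<exists>T. open T \<and> s \<in> T \<and> T \<subseteq> Z" by (intro exI[of _ V]) (auto simp: Z_def)
  qed
  have "\<exists>V. open V \<and> s \<in> V \<and> V \<inter> Z = {}" if s: "s \<in> I" "s \<notin> Z" for s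
  proof -
    obtain r a where r: "r > 0" and a: "\<And>t. \<bar>t - s\<bar> < r \<Longrightarrow> (\<lambda>n. a n * (t - s) ^ n) sums f t"
      using f s unfolding real_analytic1_on_def by metis
    have B: "open {t. \<bar>t - s\<bar> < r}" "s \<in> {t. \<bar>t - s\<bar> < r}"
      using r by (auto intro!: open_Collect_less continuous_intros)
    have "{t. \<bar>t - s\<bar> < r} \<inter> Z = {}"
    proof (rule ccontr)
      assume "{t. \<bar>t - s\<bar> < r} \<inter> Z \<noteq> {}"
      then obtain v V where v: "\<bar>v - s\<bar> < r" "open V" "v \<in> V" "\<forall>v\<in>V. f v = 0" by (auto simp: Z_def)
      have "f t = 0" if "\<bar>t - s\<bar> < r" for t
        by (rule real_power_series_eq_0[OF a _ _ _ _ that, of "{t. \<bar>t - s\<bar> < r} \<inter> V"])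
           (use v B in \<open>auto intro!: open_Int\<close>)
      with B have "s \<in> Z" unfolding Z_def by blast
      with s show False by simp
    qed
    with B show ?thesis by blast
  qed
  then obtain W where W: "\<And>s. s \<in> I \<Longrightarrow> s \<notin> Z \<Longrightarrow> open (W s) \<and> s \<in> W s \<and> W s \<inter> Z = {}"
    by metis
  define Y where "Y = (\<Union>s\<in>I - Z. W s)"
  have "open Y" using W by (auto simp: Y_def)
  have "t \<in> Z"
  proof (rule ccontr)
    assume "t \<notin> Z"
    with t W have "t \<in> Y \<inter> I" by (auto simp: Y_def)
    moreover have "U \<subseteq> Z" using U by (auto simp: Z_def)
    moreover have "I \<subseteq> Z \<union> Y" using W by (auto simp: Y_def)
    moreover have "Z \<inter> Y \<inter> I = {}" using W by (auto simp: Y_def)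
    ultimately show False
      using connectedD[OF I \<open>open Z\<close> \<open>open Y\<close>] U by blast
  qed
  then show ?thesis by (auto simp: Z_def)
qed

lemma real_analytic1_diff:
  assumes "real_analytic1_on f I" "real_analytic1_on g I"
  shows "real_analytic1_on (\<lambda>t. f t - g t) I"
  unfolding real_analytic1_on_def
proof
  fix t0 assume t0: "t0 \<in> I"
  obtain r a where r: "r > 0" "\<And>t. \<bar>t - t0\<bar> < r \<Longrightarrow> (\<lambda>n. a n * (t - t0) ^ n) sums f t"
    using assms t0 unfolding real_analytic1_on_def by metis
  obtain s b where s: "s > 0" "\<And>t. \<bar>t - t0\<bar> < s \<Longrightarrow> (\<lambda>n. b n * (t - t0) ^ n) sums g t"
    using assms t0 unfolding real_analytic1_on_def by metis
  have "(\<lambda>n. (a n - b n) * (t - t0) ^ n) sums (f t - g t)" if "\<bar>t - t0\<bar> < min r s" for t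
    using sums_diff[OF r(2) s(2), of t] that by (simp add: left_diff_distrib)
  then show "\<exists>r>0. \<exists>a. \<forall>t. \<bar>t - t0\<bar> < r \<longrightarrow> (\<lambda>n. a n * (t - t0) ^ n) sums (f t - g t)"
    using r s by (intro exI[of _ "min r s"] conjI exI[of _ "\<lambda>n. a n - b n"]) auto
qed

lemma real_analytic2_slice_fst:
  assumes F: "real_analytic2_on F U"
  shows "real_analytic1_on (\<lambda>x. F x y) {x. (x, y) \<in> U}"
  unfolding real_analytic1_on_def
proof
  fix x0 assume "x0 \<in> {x. (x, y) \<in> U}"
  then obtain r c where r: "r > 0"
    and c: "\<And>x z. \<bar>x - x0\<bar> < r \<Longrightarrow> \<bar>z - y\<bar> < r \<Longrightarrow>
          ((\<lambda>(i, j). c i j * (x - x0) ^ i * (z - y) ^ j) has_sum F x z) UNIV"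
    using F unfolding real_analytic2_on_def by fastforce
  have "(\<lambda>i. c i 0 * (x - x0) ^ i) sums F x y" if x: "\<bar>x - x0\<bar> < r" for x
  proof -
    have "((\<lambda>(i, j). c i j * (x - x0) ^ i * (y - y) ^ j) has_sum F x y) UNIV"
      using c[OF x, of y] r by simp
    then have "((\<lambda>(i, j). c i j * (x - x0) ^ i * (y - y) ^ j) has_sum F x y) (range (\<lambda>i. (i, 0)))"
      by (rule has_sum_cong_neutral[THEN iffD1, rotated -1]) (auto simp: image_iff)
    then have "((\<lambda>i. c i 0 * (x - x0) ^ i) has_sum F x y) UNIV"
      by (subst (asm) has_sum_reindex) (auto simp: inj_on_def o_def)
    then show ?thesis by (rule has_sum_imp_sums)
  qed
  with r show "\<exists>r>0. \<exists>a. \<forall>x. \<bar>x - x0\<bar> < r \<longrightarrow> (\<lambda>n. a n * (x - x0) ^ n) sums F x y"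
    by (intro exI[of _ r] conjI exI[of _ "\<lambda>i. c i 0"]) auto
qed

lemma real_analytic2_swap:
  assumes F: "real_analytic2_on F U"
  shows "real_analytic2_on (\<lambda>y x. F x y) (prod.swap ` U)"
  unfolding real_analytic2_on_def
proof
  fix p assume "p \<in> prod.swap ` U"
  then obtain x0 y0 where p: "p = (y0, x0)" "(x0, y0) \<in> U" by auto
  then obtain r c where r: "r > 0"
    and c: "\<And>x y. \<bar>x - x0\<bar> < r \<Longrightarrow> \<bar>y - y0\<bar> < r \<Longrightarrow>
          ((\<lambda>(i, j). c i j * (x - x0) ^ i * (y - y0) ^ j) has_sum F x y) UNIV"
    using F unfolding real_analytic2_on_def by fastforce
  have "((\<lambda>(j, i). c i j * (y - y0) ^ j * (x - x0) ^ i) has_sum F x y) UNIV"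
    if "\<bar>x - x0\<bar> < r" "\<bar>y - y0\<bar> < r" for x y
  proof -
    have "((\<lambda>(i, j). c i j * (x - x0) ^ i * (y - y0) ^ j) has_sum F x y) (prod.swap ` UNIV)"
      using c[OF that] by simp
    then show ?thesis by (subst (asm) has_sum_reindex) (auto simp: o_def case_prod_unfold mult_ac)
  qed
  then show "case p of (y0, x0) \<Rightarrow> \<exists>r>0. \<exists>c. \<forall>y x. \<bar>y - y0\<bar> < r \<longrightarrow> \<bar>x - x0\<bar> < r \<longrightarrow>
      ((\<lambda>(i, j). c i j * (y - y0) ^ i * (x - x0) ^ j) has_sum F x y) UNIV"
    unfolding p prod.case
    using r by (intro exI[of _ r] conjI exI[of _ "\<lambda>i j. c j i"]) auto
qed

text \<open>The difference of two continuations vanishes where \<open>2 \<surd>x + |y| < 1\<close>. For a fixed \<open>x < 1/16\<close> this contains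
\<open>|y| < 1/2\<close>, so the difference vanishes on the whole vertical line through \<open>x\<close>; hence every
horizontal half-line carries an interval of zeros.\<close>

lemma horn_H4_continuation_unique:
  assumes F: "horn_H4_continuation \<alpha> \<beta> \<gamma> \<delta> F" and G: "horn_H4_continuation \<alpha> \<beta> \<gamma> \<delta> G"
    and x: "x > 0"
  shows "F x y = G x y"
proof -
  have an: "real_analytic2_on F ({0<..} \<times> UNIV)" "real_analytic2_on G ({0<..} \<times> UNIV)"
    using F G by (auto simp: horn_H4_continuation_def)
  have agree: "F s t - G s t = 0" if "s > 0" "2 * sqrt s + \<bar>t\<bar> < 1" for s t
    using F G that by (auto simp: horn_H4_continuation_def)
  have small: "F s y - G s y = 0" if s: "s \<in> {0<..<1/16}" for s
  proof -
    have sq: "2 * sqrt s < 1 / 2"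
      using s real_sqrt_less_iff[of s "1/16"] by (simp add: real_sqrt_divide)
    have "(s, t) \<in> {0<..} \<times> UNIV" for t :: real using s by auto
    then have slice: "{t. (t, s) \<in> prod.swap ` ({0<..} \<times> UNIV)} = UNIV" by force
    show ?thesis
    proof (rule real_analytic1_identity[where I = UNIV and U = "{-1/2<..<1/2}" and f = "\<lambda>t. F s t - G s t"])
      show "real_analytic1_on (\<lambda>t. F s t - G s t) UNIV"
        using an[THEN real_analytic2_swap, THEN real_analytic2_slice_fst, of s]
        unfolding slice by (rule real_analytic1_diff)
      show "F s t - G s t = 0" if "t \<in> {-1/2<..<1/2}" for t
        using agree[of s t] s that sq by auto
    qed auto
  qed
  have "F x y - G x y = 0"
  proof (rule real_analytic1_identity[where I = "{0<..}" and U = "{0<..<1/16}" and f = "\<lambda>s. F s y - G s y"])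
    show "real_analytic1_on (\<lambda>s. F s y - G s y) {0<..}"
      using real_analytic1_diff[OF an[THEN real_analytic2_slice_fst, of y]] by (simp add: greaterThan_def)
  qed (use small x in auto)
  then show ?thesis by simp
qed

lemma horn_H4_eqI:
  assumes F: "horn_H4_continuation \<alpha> \<beta> \<gamma> \<delta> F" and x: "x > 0"
  shows "horn_H4 \<alpha> \<beta> \<gamma> \<delta> (- x) y = F x y"
proof (cases "2 * sqrt x + \<bar>y\<bar> < 1")
  case True
  then show ?thesis using F x by (simp add: horn_H4_def horn_H4_continuation_def)
next
  case False
  have "(THE w. \<exists>F. horn_H4_continuation \<alpha> \<beta> \<gamma> \<delta> F \<and> w = F x y) = F x y"
    by (rule the_equality) (use F horn_H4_continuation_unique[OF _ F x] in blast)+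
  then show ?thesis using False x by (simp add: horn_H4_def)
qed

section \<open>Double series and real-analyticity\<close>

lemma summable_on_sums_imp_has_sum:
  fixes f :: "nat \<Rightarrow> 'a :: real_normed_vector"
  assumes "f summable_on UNIV" "f sums s"
  shows "(f has_sum s) UNIV"
  using assms has_sum_imp_sums has_sum_infsum sums_unique2 by blast

text \<open>Fubini for series, stated with \<open>sums\<close> for the inner and outer sums, because it is in this form that
Taylor and binomial expansions are available.\<close>

lemma has_sum_nat_pairI:
  fixes f :: "nat \<times> nat \<Rightarrow> complex"
  assumes abs: "(\<lambda>p. norm (f p)) summable_on UNIV"
    and inner: "\<And>j. (\<lambda>i. f (i, j)) sums g j" and outer: "g sums S"
  shows "(f has_sum S) UNIV"
proof -
  have f: "f summable_on UNIV" using abs by (rule abs_summable_summable)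
  have sw: "(\<lambda>(j, i). f (i, j)) summable_on UNIV \<times> UNIV"
    using summable_on_swap[of f UNIV UNIV] f by (simp add: case_prod_unfold prod.swap_def o_def)
  have inner': "((\<lambda>i. f (i, j)) has_sum g j) UNIV" for j
    by (rule summable_on_sums_imp_has_sum[OF _ inner]) (rule summable_on_SigmaD1[OF sw], simp)
  have "(\<lambda>j. \<Sum>\<^sub>\<infinity>i. f (i, j)) = g"
    by (rule ext) (rule infsumI[OF inner'])
  moreover have "(\<lambda>i. f (i, j)) summable_on UNIV" for j
    using inner' by (auto simp: summable_on_def)
  ultimately have "g summable_on UNIV"
    using summable_on_SigmaD[OF sw] by simp
  then have "(g has_sum S) UNIV" using outer by (rule summable_on_sums_imp_has_sum)
  then have "((\<lambda>(j, i). f (i, j)) has_sum S) (UNIV \<times> UNIV)"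
    by (intro has_sum_SigmaI[OF _ _ sw, of g]) (use inner' in auto)
  then show ?thesis
    using has_sum_swap[of f UNIV UNIV S] by (simp add: case_prod_unfold prod.swap_def o_def)
qed

lemma suminf_suminf_eq_of_has_sum:
  fixes f :: "nat \<times> nat \<Rightarrow> real"
  assumes "(f has_sum S) UNIV"
  shows "(\<Sum>i. \<Sum>j. f (i, j)) = S"
proof -
  have S: "(f has_sum S) (UNIV \<times> UNIV)" using assms by simp
  then have "(\<lambda>(i, j). f (i, j)) summable_on UNIV \<times> UNIV" by (auto simp: summable_on_def)
  then have "(\<lambda>j. f (i, j)) summable_on UNIV" for i by (rule summable_on_SigmaD1) simp
  then have inner: "((\<lambda>j. f (i, j)) has_sum (\<Sum>\<^sub>\<infinity>j. f (i, j))) UNIV" for i by (rule has_sum_infsum)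
  then have "(\<Sum>j. f (i, j)) = (\<Sum>\<^sub>\<infinity>j. f (i, j))" for i
    using has_sum_imp_sums sums_unique by metis
  moreover have "((\<lambda>i. \<Sum>\<^sub>\<infinity>j. f (i, j)) has_sum S) UNIV"
    by (rule has_sum_SigmaD[OF S]) (rule inner)
  ultimately show ?thesis
    using has_sum_imp_sums sums_unique by fastforce
qed

lemma summable_on_geometric_pair:
  fixes p q :: real
  assumes "0 \<le> p" "p < 1" "0 \<le> q" "q < 1"
  shows "(\<lambda>(i, j). p ^ i * q ^ j) summable_on (UNIV :: (nat \<times> nat) set)"
proof -
  have geo: "((\<lambda>j. p ^ i * q ^ j) has_sum p ^ i * (1 / (1 - q))) UNIV" for i
    using assms geometric_sums[of q]
    by (intro has_sum_cmult_right sums_nonneg_imp_has_sum) auto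
  have "(\<lambda>i. p ^ i * (1 / (1 - q))) summable_on UNIV"
    using assms by (intro summable_on_cmult_left summable_nonneg_imp_summable_on summable_geometric) auto
  then show ?thesis
    using summable_on_SigmaI[where A = UNIV and B = "\<lambda>_. UNIV" and f = "\<lambda>(i, j). p ^ i * q ^ j"
        and g = "\<lambda>i. p ^ i * (1 / (1 - q))"] geo assms by auto
qed

text \<open>Expand first in \<open>y\<close>, then expand each Taylor coefficient, a holomorphic function of \<open>x\<close>, around \<open>x0\<close>.
Cauchy's estimate applied twice bounds the coefficient of index \<open>(i, j)\<close> by \<open>M / r ^ (i + j)\<close>, which makes the
double series absolutely convergent.\<close>

lemma holomorphic_double_power_series:
  fixes K :: "complex \<Rightarrow> complex \<Rightarrow> complex"
  assumes hol_y: "\<And>x. x \<in> ball x0 R \<Longrightarrow> K x holomorphic_on ball y0 R"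
    and hol_x: "\<And>j. (\<lambda>x. (deriv ^^ j) (K x) y0) holomorphic_on ball x0 R"
    and bound: "\<And>x y. x \<in> ball x0 R \<Longrightarrow> y \<in> ball y0 R \<Longrightarrow> norm (K x y) \<le> M"
    and x: "x \<in> ball x0 R" and y: "y \<in> ball y0 R"
  shows "((\<lambda>(i, j). (deriv ^^ i) (\<lambda>x. (deriv ^^ j) (K x) y0) x0 / (fact i * fact j)
            * (x - x0) ^ i * (y - y0) ^ j) has_sum K x y) UNIV"
proof -
  define d where "d = (\<lambda>j x. (deriv ^^ j) (K x) y0)"
  \<comment> \<open>Cauchy's estimates need a closed disc inside the domain, hence the intermediate radius.\<close>
  have "max (dist x0 x) (dist y0 y) < R" using x y by auto
  then obtain r where r: "dist x0 x < r" "dist y0 y < r" "r < R"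
    using dense[of "max (dist x0 x) (dist y0 y)" R] by auto
  have r0: "0 < r" using r(1) zero_le_dist[of x0 x] by linarith
  have sub: "cball z r \<subseteq> ball z R" "ball z r \<subseteq> ball z R" for z :: complex using r by auto
  have d_bound: "norm (d j u) \<le> fact j * M / r ^ j" if "u \<in> ball x0 R" for j u
    unfolding d_def
  proof (rule Cauchy_inequality)
    show "K u holomorphic_on ball y0 r" "continuous_on (cball y0 r) (K u)"
      by (intro holomorphic_on_imp_continuous_on holomorphic_on_subset[OF hol_y[OF that]] sub)+
    show "norm (K u v) \<le> M" if "norm (y0 - v) = r" for v
      using that r \<open>u \<in> ball x0 R\<close> by (intro bound) (auto simp: dist_norm)
  qed (rule r0)
  have dd_bound: "norm ((deriv ^^ i) (d j) x0) \<le> fact i * (fact j * M / r ^ j) / r ^ i" for i j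
  proof (rule Cauchy_inequality)
    show "d j holomorphic_on ball x0 r" "continuous_on (cball x0 r) (d j)"
      unfolding d_def
      by (intro holomorphic_on_imp_continuous_on holomorphic_on_subset[OF hol_x] sub)+
    show "norm (d j u) \<le> fact j * M / r ^ j" if "norm (x0 - u) = r" for u
      using that r by (intro d_bound) (auto simp: dist_norm)
  qed (rule r0)
  define t where "t = (\<lambda>(i, j). (deriv ^^ i) (d j) x0 / (fact i * fact j) * (x - x0) ^ i * (y - y0) ^ j)"
  define p where "p = norm (x - x0) / r"
  define q where "q = norm (y - y0) / r"
  have "(t has_sum K x y) UNIV"
  proof (rule has_sum_nat_pairI)
    have "(\<lambda>(i, j). p ^ i * q ^ j) summable_on (UNIV :: (nat \<times> nat) set)"
      using r r0 by (intro summable_on_geometric_pair)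
        (auto simp: p_def q_def dist_norm norm_minus_commute)
    then have "(\<lambda>ij. M * (case ij of (i, j) \<Rightarrow> p ^ i * q ^ j)) summable_on (UNIV :: (nat \<times> nat) set)"
      by (rule summable_on_cmult_right)
    then show "(\<lambda>ij. norm (t ij)) summable_on UNIV"
    proof (rule Infinite_Sum.abs_summable_on_comparison_test')
      fix ij :: "nat \<times> nat"
      obtain i j where ij: "ij = (i, j)" by fastforce
      have "norm (t ij) = norm ((deriv ^^ i) (d j) x0) * (norm (x - x0) ^ i * norm (y - y0) ^ j / (fact i * fact j))"
        by (simp add: t_def ij norm_mult norm_divide norm_power)
      also have "\<dots> \<le> fact i * (fact j * M / r ^ j) / r ^ i * (norm (x - x0) ^ i * norm (y - y0) ^ j / (fact i * fact j))"
        by (intro mult_right_mono dd_bound) auto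
      also have "\<dots> = M * (p ^ i * q ^ j)"
        using r0 by (simp add: p_def q_def power_divide field_simps)
      finally show "norm (t ij) \<le> M * (case ij of (i, j) \<Rightarrow> p ^ i * q ^ j)" by (simp add: ij)
    qed
  next
    show "(\<lambda>i. t (i, j)) sums (d j x / fact j * (y - y0) ^ j)" for j
    proof -
      have "(\<lambda>i. (deriv ^^ i) (d j) x0 / fact i * (x - x0) ^ i) sums d j x"
        by (rule holomorphic_power_series[OF _ x]) (use hol_x in \<open>simp add: d_def\<close>)
      then have "(\<lambda>i. (deriv ^^ i) (d j) x0 / fact i * (x - x0) ^ i * ((y - y0) ^ j / fact j))
          sums (d j x * ((y - y0) ^ j / fact j))"
        by (rule sums_mult2)
      then show ?thesis by (simp add: t_def mult_ac)
    qed
    show "(\<lambda>j. d j x / fact j * (y - y0) ^ j) sums K x y"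
      unfolding d_def by (rule holomorphic_power_series[OF hol_y[OF x] y])
  qed
  then show ?thesis by (simp add: t_def d_def)
qed

text \<open>For a function of the form \<open>g x * \<Phi> (h x * y)\<close> the Taylor coefficients in \<open>y\<close> are explicit, namely
\<open>g x * h x ^ j * (deriv ^^ j) \<Phi> (h x * y0)\<close> up to \<open>j!\<close>, and hence visibly holomorphic in \<open>x\<close>. This avoids
the general theory of functions of several complex variables.\<close>

lemma real_analytic2_on_Re:
  fixes A B :: "complex set"
  assumes g: "g holomorphic_on A" and h: "h holomorphic_on A" and A: "open A"
    and \<Phi>: "\<Phi> holomorphic_on B" and B: "open B"
    and U: "\<And>x y. (x, y) \<in> U \<Longrightarrow> of_real x \<in> A \<and> h (of_real x) * of_real y \<in> B"
  shows "real_analytic2_on (\<lambda>x y. Re (g (of_real x) * \<Phi> (h (of_real x) * of_real y))) U"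
  unfolding real_analytic2_on_def
proof clarify
  fix x0 y0 :: real assume "(x0, y0) \<in> U"
  define z0 where "z0 = complex_of_real x0"
  define w0 where "w0 = complex_of_real y0"
  define K where "K = (\<lambda>x y. g x * \<Phi> (h x * y))"
  define W where "W = (A \<times> UNIV) \<inter> (\<lambda>p. h (fst p) * snd p) -` B"
  have hcont: "continuous_on (A \<times> UNIV) (\<lambda>p. h (fst p) * snd p)"
    by (intro continuous_intros continuous_on_compose2[OF holomorphic_on_imp_continuous_on[OF h]]) auto
  \<comment> \<open>By openness and compactness, some product of closed discs around the point lies in the domain of \<open>K\<close>, and \<open>K\<close> is bounded there.\<close>
  have "open W"
    unfolding W_def by (rule continuous_open_preimage[OF hcont _ B]) (use A in \<open>auto intro: open_Times\<close>)
  moreover have "(z0, w0) \<in> W"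
    using U[OF \<open>(x0, y0) \<in> U\<close>] by (auto simp: W_def z0_def w0_def)
  ultimately obtain X Y where XY: "open X" "open Y" "z0 \<in> X" "w0 \<in> Y" "X \<times> Y \<subseteq> W"
    by (auto elim: open_prod_elim)
  obtain R1 where R1: "R1 > 0" "cball z0 R1 \<subseteq> X" using XY open_contains_cball by blast
  obtain R2 where R2: "R2 > 0" "cball w0 R2 \<subseteq> Y" using XY open_contains_cball by blast
  define R where "R = min R1 R2"
  have "cball z0 R \<subseteq> X" "cball w0 R \<subseteq> Y" using R1 R2 by (auto simp: R_def)
  then have R: "R > 0" "cball z0 R \<times> cball w0 R \<subseteq> W" using R1 R2 XY(5) by (auto simp: R_def)
  then have in_A: "x \<in> A" and in_B: "h x * y \<in> B" if "x \<in> cball z0 R" "y \<in> cball w0 R" for x y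
    using subsetD[OF R(2), of "(x, y)"] that by (auto simp: W_def)
  have Kcont: "continuous_on W (\<lambda>p. K (fst p) (snd p))"
    unfolding K_def
    by (intro continuous_on_mult continuous_on_compose2[OF holomorphic_on_imp_continuous_on[OF g]]
          continuous_on_compose2[OF holomorphic_on_imp_continuous_on[OF \<Phi>]]
          continuous_on_subset[OF hcont] continuous_on_fst continuous_on_id) (auto simp: W_def)
  have "bounded ((\<lambda>p. K (fst p) (snd p)) ` (cball z0 R \<times> cball w0 R))"
    by (intro compact_imp_bounded compact_continuous_image continuous_on_subset[OF Kcont R(2)] compact_Times compact_cball)
  then obtain M where "\<forall>p\<in>cball z0 R \<times> cball w0 R. norm (K (fst p) (snd p)) \<le> M"
    unfolding bounded_iff by blast
  then have M: "norm (K x y) \<le> M" if "x \<in> cball z0 R" "y \<in> cball w0 R" for x y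
    using that by force
  have deriv_K: "(deriv ^^ j) (K x) w0 = g x * (h x ^ j * (deriv ^^ j) \<Phi> (h x * w0))"
    if x: "x \<in> ball z0 R" for j x
  proof -
    have maps: "h x * y \<in> B" if "y \<in> ball w0 R" for y using in_B[of x y] x that by auto
    have "(\<lambda>y. \<Phi> (h x * y)) holomorphic_on ball w0 R"
      using maps by (intro holomorphic_on_compose_gen[OF _ \<Phi>, unfolded o_def] holomorphic_intros) auto
    then have "(deriv ^^ j) (K x) w0 = g x * (deriv ^^ j) (\<lambda>y. \<Phi> (h x * y)) w0"
      unfolding K_def using R by (intro higher_deriv_cmult) auto
    also have "(deriv ^^ j) (\<lambda>y. \<Phi> (h x * y)) w0 = h x ^ j * (deriv ^^ j) \<Phi> (h x * w0)"
      using R maps by (intro higher_deriv_compose_linear[OF \<Phi> _ B, of "ball w0 R"]) auto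
    finally show ?thesis .
  qed
  have K_sum: "((\<lambda>(i, j). (deriv ^^ i) (\<lambda>x. (deriv ^^ j) (K x) w0) z0 / (fact i * fact j)
            * (x - z0) ^ i * (y - w0) ^ j) has_sum K x y) UNIV"
    if x: "x \<in> ball z0 R" and y: "y \<in> ball w0 R" for x y
  proof (rule holomorphic_double_power_series[OF _ _ _ x y])
    show "K u holomorphic_on ball w0 R" if u: "u \<in> ball z0 R" for u
      unfolding K_def
      using in_B[of u] u
      by (intro holomorphic_intros holomorphic_on_compose_gen[OF _ \<Phi>, unfolded o_def]) auto
    show "(\<lambda>x. (deriv ^^ j) (K x) w0) holomorphic_on ball z0 R" for j
    proof (subst holomorphic_cong[OF refl deriv_K])
      have sub: "ball z0 R \<subseteq> A" using in_A[of _ w0] R by auto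
      show "(\<lambda>x. g x * (h x ^ j * (deriv ^^ j) \<Phi> (h x * w0))) holomorphic_on ball z0 R"
        using in_B[of _ w0] R
        by (intro holomorphic_intros holomorphic_on_subset[OF g sub] holomorphic_on_subset[OF h sub]
             holomorphic_on_compose_gen[OF _ holomorphic_higher_deriv[OF \<Phi> B], unfolded o_def]) auto
    qed
    show "norm (K u v) \<le> M" if "u \<in> ball z0 R" "v \<in> ball w0 R" for u v
      using that by (intro M) auto
  qed
  define c where "c = (\<lambda>i j. (deriv ^^ i) (\<lambda>x. (deriv ^^ j) (K x) w0) z0 / (fact i * fact j))"
  have "((\<lambda>(i, j). Re (c i j) * (x - x0) ^ i * (y - y0) ^ j) has_sum
      Re (g (of_real x) * \<Phi> (h (of_real x) * of_real y))) UNIV"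
    if "\<bar>x - x0\<bar> < R" "\<bar>y - y0\<bar> < R" for x y
  proof -
    have "((\<lambda>(i, j). c i j * (of_real x - z0) ^ i * (of_real y - w0) ^ j) has_sum
        K (of_real x) (of_real y)) UNIV"
      unfolding c_def using that
      by (intro K_sum) (auto simp: z0_def w0_def dist_of_real dist_real_def abs_minus_commute)
    from has_sum_Re[OF this] show ?thesis
      by (simp add: K_def z0_def w0_def case_prod_unfold mult.assoc flip: of_real_diff of_real_power of_real_mult)
  qed
  then show "\<exists>r>0. \<exists>c. \<forall>x y. \<bar>x - x0\<bar> < r \<longrightarrow> \<bar>y - y0\<bar> < r \<longrightarrow>
      ((\<lambda>(i, j). c i j * (x - x0) ^ i * (y - y0) ^ j) has_sum
        Re (g (of_real x) * \<Phi> (h (of_real x) * of_real y))) UNIV"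
    using R(1) by (intro exI[of _ R] conjI exI[of _ "\<lambda>i j. Re (c i j)"]) auto
qed

section \<open>The double series in the domain of convergence\<close>

text \<open>Summed along the diagonals \<open>m + n = N\<close>, this is the geometric series of \<open>(p + q) ^ N\<close>.\<close>

lemma summable_on_binomial_pair:
  fixes p q :: real
  assumes "0 \<le> p" "0 \<le> q" "p + q < 1"
  shows "(\<lambda>(m, n). real ((m + n) choose n) * p ^ m * q ^ n) summable_on (UNIV :: (nat \<times> nat) set)"
proof -
  have "(\<lambda>(N, n). real (N choose n) * p ^ (N - n) * q ^ n) summable_on (SIGMA N:UNIV. {..N})"
  proof (rule summable_on_SigmaI)
    fix N :: nat
    have "((\<lambda>n. real (N choose n) * p ^ (N - n) * q ^ n) has_sum
        (\<Sum>n\<le>N. real (N choose n) * p ^ (N - n) * q ^ n)) {..N}"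
      by (rule has_sum_finite) simp
    also have "(\<Sum>n\<le>N. real (N choose n) * p ^ (N - n) * q ^ n) = (p + q) ^ N"
      by (subst add.commute) (simp add: binomial_ring mult_ac)
    finally show "((\<lambda>n. case (N, n) of (N, n) \<Rightarrow> real (N choose n) * p ^ (N - n) * q ^ n) has_sum (p + q) ^ N) {..N}"
      by simp
  next
    show "(\<lambda>N. (p + q) ^ N) summable_on UNIV"
      using assms by (intro summable_nonneg_imp_summable_on summable_geometric) auto
  qed (use assms in auto)
  also have "?this \<longleftrightarrow> ?thesis"
    by (rule summable_on_reindex_bij_witness[of _ "\<lambda>(m, n). (m + n, n)" "\<lambda>(N, n). (N - n, n)"]) auto
  finally show ?thesis .
qed

text \<open>After writing \<open>(a)\<^bsub>n+m\<^esub> / (n! m!)\<close> as a binomial coefficient times \<open>(a)\<^bsub>n+m\<^esub> / (n+m)!\<close>, the bounds on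
Pochhammer ratios reduce the claim to the binomial case, at the price of an arbitrarily small
dilation \<open>q * q\<close> of both variables.\<close>

lemma hypergeo_double_series_abs_summable:
  fixes a b c \<zeta> y :: complex
  assumes c: "c \<notin> \<int>\<^sub>\<le>\<^sub>0" and dom: "norm \<zeta> + norm y < 1"
  shows "(\<lambda>p. norm (case p of (m, n) \<Rightarrow> pochhammer a (n + m) * pochhammer b n
        / (pochhammer c n * fact n * fact m) * (- \<zeta>) ^ m * y ^ n)) summable_on UNIV"
proof -
  obtain q where q: "1 < q" "q * q * (norm \<zeta> + norm y) < 1"
    using exists_square_mult_less_1[OF dom] .
  have one: "(1::complex) \<notin> \<int>\<^sub>\<le>\<^sub>0" by auto
  obtain C where C: "0 < C" "\<And>n. norm (pochhammer b n / pochhammer c n) \<le> C * q ^ n"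
    using pochhammer_ratio_bound[OF c q(1)] by blast
  obtain D where D: "0 < D" "\<And>n. norm (pochhammer a n / pochhammer 1 n) \<le> D * q ^ n"
    using pochhammer_ratio_bound[OF one q(1)] by blast
  define P where "P = q * q * norm \<zeta>"
  define Q where "Q = q * q * norm y"
  have "(\<lambda>(m, n). real ((m + n) choose n) * P ^ m * Q ^ n) summable_on (UNIV :: (nat \<times> nat) set)"
    using q by (intro summable_on_binomial_pair) (auto simp: P_def Q_def distrib_left)
  then have "(\<lambda>p. D * C * (case p of (m, n) \<Rightarrow> real ((m + n) choose n) * P ^ m * Q ^ n))
      summable_on (UNIV :: (nat \<times> nat) set)"
    by (rule summable_on_cmult_right)
  then show "(\<lambda>p. norm (case p of (m, n) \<Rightarrow> pochhammer a (n + m) * pochhammer b n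
        / (pochhammer c n * fact n * fact m) * (- \<zeta>) ^ m * y ^ n)) summable_on UNIV"
  proof (rule Infinite_Sum.abs_summable_on_comparison_test')
    fix p :: "nat \<times> nat"
    obtain m n where p: "p = (m, n)" by fastforce
    let ?t = "pochhammer a (n + m) * pochhammer b n / (pochhammer c n * fact n * fact m) * (- \<zeta>) ^ m * y ^ n"
    have "?t = of_nat ((m + n) choose n) * (pochhammer a (n + m) / pochhammer 1 (n + m)) *
        (pochhammer b n / pochhammer c n) * (- \<zeta>) ^ m * y ^ n"
      by (simp add: binomial_fact add.commute flip: pochhammer_fact)
    then have "norm ?t = real ((m + n) choose n) * norm (pochhammer a (n + m) / pochhammer 1 (n + m)) *
        norm (pochhammer b n / pochhammer c n) * norm \<zeta> ^ m * norm y ^ n"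
      by (simp add: norm_mult norm_power norm_divide)
    also have "\<dots> \<le> real ((m + n) choose n) * (D * q ^ (n + m)) * (C * q ^ n) * norm \<zeta> ^ m * norm y ^ n"
      using C D q by (intro mult_right_mono mult_mono) auto
    also have "\<dots> \<le> real ((m + n) choose n) * (D * q ^ (n + m)) * (C * q ^ (n + m)) * norm \<zeta> ^ m * norm y ^ n"
      using C D q by (intro mult_right_mono mult_left_mono power_increasing) auto
    also have "\<dots> = D * C * (real ((m + n) choose n) * P ^ m * Q ^ n)"
      by (simp add: P_def Q_def power_mult_distrib power_add mult_ac)
    finally show "norm (case p of (m, n) \<Rightarrow> pochhammer a (n + m) * pochhammer b n
        / (pochhammer c n * fact n * fact m) * (- \<zeta>) ^ m * y ^ n)
       \<le> D * C * (case p of (m, n) \<Rightarrow> real ((m + n) choose n) * P ^ m * Q ^ n)"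
      by (simp add: p)
  qed
qed

text \<open>For fixed \<open>n\<close> the sum over \<open>m\<close> is the binomial series of \<open>(1 + \<zeta>) powr (- a - n)\<close>, because
\<open>(a)\<^bsub>n+m\<^esub> = (a)\<^bsub>n\<^esub> (a + n)\<^bsub>m\<^esub>\<close>.\<close>

lemma hypergeo_double_series:
  fixes a b c \<zeta> y :: complex
  assumes c: "c \<notin> \<int>\<^sub>\<le>\<^sub>0" and dom: "norm \<zeta> + norm y < 1"
  shows "((\<lambda>(m, n). pochhammer a (n + m) * pochhammer b n / (pochhammer c n * fact n * fact m)
            * (- \<zeta>) ^ m * y ^ n) has_sum
         (1 + \<zeta>) powr (- a) * eval_fps (fps_hypergeo [a, b] [c] 1) (y / (1 + \<zeta>))) UNIV"
proof (rule has_sum_nat_pairI)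
  show "(\<lambda>p. norm (case p of (m, n) \<Rightarrow> pochhammer a (n + m) * pochhammer b n
        / (pochhammer c n * fact n * fact m) * (- \<zeta>) ^ m * y ^ n)) summable_on UNIV"
    by (rule hypergeo_double_series_abs_summable[OF assms])
  have \<zeta>: "norm \<zeta> < 1" using dom norm_ge_zero[of y] by linarith
  have nz: "1 + \<zeta> \<noteq> 0" using \<zeta> by (metis add.inverse_unique norm_minus_cancel norm_one order_less_irrefl)
  define g where "g = (\<lambda>n. (1 + \<zeta>) powr (- a) * (fps_nth (fps_hypergeo [a, b] [c] 1) n * (y / (1 + \<zeta>)) ^ n))"
  show "(\<lambda>m. case (m, n) of (m, n) \<Rightarrow> pochhammer a (n + m) * pochhammer b n
        / (pochhammer c n * fact n * fact m) * (- \<zeta>) ^ m * y ^ n) sums g n" for n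
  proof -
    have "(\<lambda>m. ((- (a + of_nat n)) gchoose m) * \<zeta> ^ m) sums (1 + \<zeta>) powr (- (a + of_nat n))"
      by (rule gen_binomial_complex[OF \<zeta>])
    moreover have "((- (a + of_nat n)) gchoose m) * \<zeta> ^ m = pochhammer (a + of_nat n) m / fact m * (- \<zeta>) ^ m" for m
      unfolding power_minus[of \<zeta>] by (simp add: gbinomial_pochhammer add.commute)
    moreover have "(1 + \<zeta>) powr (- (a + of_nat n)) = (1 + \<zeta>) powr (- a) / (1 + \<zeta>) ^ n"
      using nz by (simp add: powr_diff powr_nat')
    ultimately have "(\<lambda>m. pochhammer (a + of_nat n) m / fact m * (- \<zeta>) ^ m) sums
        ((1 + \<zeta>) powr (- a) / (1 + \<zeta>) ^ n)"
      by simp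
    then have "(\<lambda>m. pochhammer a n * pochhammer b n / (pochhammer c n * fact n) * y ^ n *
          (pochhammer (a + of_nat n) m / fact m * (- \<zeta>) ^ m)) sums
        (pochhammer a n * pochhammer b n / (pochhammer c n * fact n) * y ^ n * ((1 + \<zeta>) powr (- a) / (1 + \<zeta>) ^ n))"
      by (rule sums_mult)
    then show ?thesis by (simp add: g_def pochhammer_product' power_divide mult_ac)
  qed
  have "1 - norm \<zeta> \<le> norm (1 + \<zeta>)" using norm_triangle_ineq4[of "1 + \<zeta>" \<zeta>] by simp
  then have "norm (y / (1 + \<zeta>)) < 1" using dom nz by (simp add: norm_divide divide_simps)
  then have "ereal (norm (y / (1 + \<zeta>))) < fps_conv_radius (fps_hypergeo [a, b] [c] 1)"
    by (rule less_fps_conv_radius_hypergeo[OF c])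
  then show "g sums ((1 + \<zeta>) powr (- a) * eval_fps (fps_hypergeo [a, b] [c] 1) (y / (1 + \<zeta>)))"
    unfolding g_def by (intro sums_mult sums_eval_fps)
qed

lemma fact_double: "fact (2 * k) = (4 ^ k * fact k * pochhammer (1 / 2) k :: real)"
proof -
  have "pochhammer 1 (2 * k) = real (2 ^ (2 * k)) * pochhammer (1 / 2) k * pochhammer 1 k"
    using pochhammer_double[of "1 / 2 :: real" k] by simp
  then show ?thesis unfolding pochhammer_fact[symmetric] by (simp add: power_mult)
qed

lemma fact_Suc_double: "fact (Suc (2 * k)) = (4 ^ k * fact k * pochhammer (3 / 2) k :: real)"
proof -
  have "(1 / 2) * pochhammer (3 / 2) k = pochhammer (1 / 2) k * (1 / 2 + real k)"
    using pochhammer_rec[of "1 / 2 :: real" k] pochhammer_rec'[of "1 / 2 :: real" k]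
    by (simp add: mult_ac)
  then have "pochhammer (3 / 2) k = pochhammer (1 / 2) k * (1 + 2 * real k)" by (simp add: algebra_simps)
  moreover have "fact (Suc (2 * k)) = (1 + 2 * real k) * fact (2 * k)" by (simp add: algebra_simps)
  ultimately show ?thesis by (simp add: fact_double del: fact_Suc)
qed

text \<open>Even powers of \<open>- i \<tau>\<close> are real and odd ones are imaginary, so taking real and imaginary parts selects
the terms of even and of odd first index.\<close>

lemma has_sum_imaginary_powers:
  fixes c :: "nat \<Rightarrow> nat \<Rightarrow> real" and \<tau> :: real
  assumes S: "((\<lambda>(m, n). of_real (c m n) * (- (\<i> * of_real \<tau>)) ^ m) has_sum S) UNIV"
  shows has_sum_imaginary_powers_Re: "((\<lambda>(k, n). c (2 * k) n * (- (\<tau>\<^sup>2)) ^ k) has_sum Re S) UNIV"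
    and has_sum_imaginary_powers_Im:
      "((\<lambda>(k, n). c (Suc (2 * k)) n * (- (\<tau>\<^sup>2)) ^ k * \<tau>) has_sum - Im S) UNIV"
proof -
  define T where "T = (\<lambda>(m, n). of_real (c m n) * (- (\<i> * of_real \<tau>)) ^ m)"
  have sq: "(- (\<i> * of_real \<tau>)) ^ 2 = complex_of_real (- (\<tau>\<^sup>2))"
    by (simp add: power_mult_distrib)
  have even_T: "T (2 * k, n) = of_real (c (2 * k) n * (- (\<tau>\<^sup>2)) ^ k)" for k n
    unfolding T_def prod.case power_mult sq by simp
  have odd_T: "T (Suc (2 * k), n) = - \<i> * of_real (c (Suc (2 * k)) n * (- (\<tau>\<^sup>2)) ^ k * \<tau>)" for k n
    unfolding T_def prod.case power_Suc power_mult sq by simp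
  have parity: "p \<in> range (\<lambda>(k, n). (2 * k, n)) \<or> p \<in> range (\<lambda>(k, n). (Suc (2 * k), n))"
    for p :: "nat \<times> nat"
  proof (cases p)
    case (Pair m n)
    then show ?thesis by (cases "even m") (auto elim!: evenE oddE simp: image_iff)
  qed
  have "((\<lambda>p. Re (T p)) has_sum Re S) UNIV"
    using has_sum_Re[OF S] by (simp add: T_def)
  then have "((\<lambda>p. Re (T p)) has_sum Re S) (range (\<lambda>(k, n). (2 * k, n)))"
  proof (rule has_sum_cong_neutral[THEN iffD1, rotated -1])
    fix p :: "nat \<times> nat" assume "p \<in> UNIV - range (\<lambda>(k, n). (2 * k, n))"
    then obtain k n where "p = (Suc (2 * k), n)" using parity[of p] by auto
    then show "Re (T p) = 0" by (simp add: odd_T)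
  qed auto
  then have "((\<lambda>p. Re (T p)) \<circ> (\<lambda>(k, n). (2 * k, n)) has_sum Re S) UNIV"
    by (subst (asm) has_sum_reindex) (auto simp: inj_on_def)
  then show "((\<lambda>(k, n). c (2 * k) n * (- (\<tau>\<^sup>2)) ^ k) has_sum Re S) UNIV"
    by (simp add: o_def case_prod_unfold even_T del: of_real_mult)
  have "((\<lambda>p. - Im (T p)) has_sum - Im S) UNIV"
    using has_sum_Im[OF S] by (simp add: T_def has_sum_uminus)
  then have "((\<lambda>p. - Im (T p)) has_sum - Im S) (range (\<lambda>(k, n). (Suc (2 * k), n)))"
  proof (rule has_sum_cong_neutral[THEN iffD1, rotated -1])
    fix p :: "nat \<times> nat" assume "p \<in> UNIV - range (\<lambda>(k, n). (Suc (2 * k), n))"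
    then obtain k n where "p = (2 * k, n)" using parity[of p] by auto
    then show "- Im (T p) = 0" by (simp add: even_T del: of_real_mult)
  qed auto
  then have "((\<lambda>p. - Im (T p)) \<circ> (\<lambda>(k, n). (Suc (2 * k), n)) has_sum - Im S) UNIV"
    by (subst (asm) has_sum_reindex) (auto simp: inj_on_def)
  then show "((\<lambda>(k, n). c (Suc (2 * k)) n * (- (\<tau>\<^sup>2)) ^ k * \<tau>) has_sum - Im S) UNIV"
    by (simp add: o_def case_prod_unfold odd_T del: of_real_mult)
qed

lemma hypergeo_double_series_imaginary:
  fixes a \<beta> \<delta> \<tau> y :: real
  assumes \<delta>: "\<delta> \<notin> \<int>\<^sub>\<le>\<^sub>0" and dom: "\<bar>\<tau>\<bar> + \<bar>y\<bar> < 1"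
  defines "S \<equiv> (1 + \<i> * of_real \<tau>) powr (- of_real a) *
       eval_fps (fps_hypergeo [of_real a, of_real \<beta>] [of_real \<delta>] 1) (of_real y / (1 + \<i> * of_real \<tau>))"
    and "c \<equiv> \<lambda>m n. pochhammer a (n + m) * pochhammer \<beta> n / (pochhammer \<delta> n * fact n * fact m) * y ^ n"
  shows "((\<lambda>(m, n). of_real (c m n) * (- (\<i> * of_real \<tau>)) ^ m) has_sum S) UNIV"
proof -
  have "((\<lambda>(m, n). pochhammer (of_real a) (n + m) * pochhammer (of_real \<beta>) n
      / (pochhammer (of_real \<delta>) n * fact n * fact m) * (- (\<i> * of_real \<tau>)) ^ m * complex_of_real y ^ n) has_sum S) UNIV"
    unfolding S_def
    by (rule hypergeo_double_series) (use \<delta> dom in \<open>auto simp: of_real_in_nonpos_Ints_iff norm_mult\<close>)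
  also have "(\<lambda>(m, n). pochhammer (of_real a) (n + m) * pochhammer (of_real \<beta>) n
      / (pochhammer (of_real \<delta>) n * fact n * fact m) * (- (\<i> * of_real \<tau>)) ^ m * complex_of_real y ^ n)
      = (\<lambda>(m, n). of_real (c m n) * (- (\<i> * of_real \<tau>)) ^ m)"
    by (simp add: c_def pochhammer_of_real fun_eq_iff mult_ac)
  finally show ?thesis .
qed

lemma horn_H4_series_half:
  fixes \<alpha> \<beta> \<delta> \<tau> y :: real
  assumes \<delta>: "\<delta> \<notin> \<int>\<^sub>\<le>\<^sub>0" and dom: "\<bar>\<tau>\<bar> + \<bar>y\<bar> < 1" and x: "\<tau>\<^sup>2 = 4 * x"
  shows "horn_H4_series \<alpha> \<beta> (1 / 2) \<delta> (- x) y =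
     Re ((1 + \<i> * of_real \<tau>) powr (- of_real \<alpha>) *
       eval_fps (fps_hypergeo [of_real \<alpha>, of_real \<beta>] [of_real \<delta>] 1) (of_real y / (1 + \<i> * of_real \<tau>)))"
    (is "_ = Re ?S")
proof -
  let ?f = "\<lambda>(k, n). pochhammer \<alpha> (2 * k + n) * pochhammer \<beta> n
       / (pochhammer (1 / 2) k * pochhammer \<delta> n) * ((- x) ^ k / fact k) * (y ^ n / fact n)"
  note has_sum_imaginary_powers_Re[OF hypergeo_double_series_imaginary[OF \<delta> dom, of \<alpha> \<beta>]]
  also have "(\<lambda>(k, n). pochhammer \<alpha> (n + 2 * k) * pochhammer \<beta> n
       / (pochhammer \<delta> n * fact n * fact (2 * k)) * y ^ n * (- (\<tau>\<^sup>2)) ^ k) = ?f"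
  proof (rule ext, clarify)
    fix k n :: nat
    have "(- (\<tau>\<^sup>2)) ^ k / fact (2 * k) = (- x) ^ k / (fact k * pochhammer (1 / 2) k)"
      using power_mult_distrib[of 4 "- x" k] unfolding fact_double x by simp
    moreover have "pochhammer \<alpha> (n + 2 * k) * pochhammer \<beta> n
       / (pochhammer \<delta> n * fact n * fact (2 * k)) * y ^ n * (- (\<tau>\<^sup>2)) ^ k =
       pochhammer \<alpha> (2 * k + n) * pochhammer \<beta> n / (pochhammer \<delta> n * fact n) * y ^ n *
         ((- (\<tau>\<^sup>2)) ^ k / fact (2 * k))"
      by (simp add: add.commute)
    ultimately show "pochhammer \<alpha> (n + 2 * k) * pochhammer \<beta> n
       / (pochhammer \<delta> n * fact n * fact (2 * k)) * y ^ n * (- (\<tau>\<^sup>2)) ^ k =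
       pochhammer \<alpha> (2 * k + n) * pochhammer \<beta> n
       / (pochhammer (1 / 2) k * pochhammer \<delta> n) * ((- x) ^ k / fact k) * (y ^ n / fact n)"
      by (simp add: mult_ac)
  qed
  finally have "(?f has_sum Re ?S) UNIV" .
  from suminf_suminf_eq_of_has_sum[OF this] show ?thesis by (simp add: horn_H4_series_def)
qed

text \<open>The factor \<open>(\<alpha> - 1) * \<tau>\<close> comes from \<open>(\<alpha> - 1)\<^bsub>n+2k+1\<^esub> = (\<alpha> - 1) (\<alpha>)\<^bsub>n+2k\<^esub>\<close> and from the odd power of \<open>\<tau>\<close>.\<close>

lemma horn_H4_series_three_halves:
  fixes \<alpha> \<beta> \<delta> \<tau> y :: real
  assumes \<delta>: "\<delta> \<notin> \<int>\<^sub>\<le>\<^sub>0" and dom: "\<bar>\<tau>\<bar> + \<bar>y\<bar> < 1" and x: "\<tau>\<^sup>2 = 4 * x"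
    and \<tau>: "\<tau> \<noteq> 0" and \<alpha>: "\<alpha> \<noteq> 1"
  shows "horn_H4_series \<alpha> \<beta> (3 / 2) \<delta> (- x) y = - 1 / ((\<alpha> - 1) * \<tau>) *
     Im ((1 + \<i> * of_real \<tau>) powr (- of_real (\<alpha> - 1)) *
       eval_fps (fps_hypergeo [of_real (\<alpha> - 1), of_real \<beta>] [of_real \<delta>] 1) (of_real y / (1 + \<i> * of_real \<tau>)))"
    (is "_ = _ * Im ?S")
proof -
  let ?f = "\<lambda>(k, n). pochhammer \<alpha> (2 * k + n) * pochhammer \<beta> n
       / (pochhammer (3 / 2) k * pochhammer \<delta> n) * ((- x) ^ k / fact k) * (y ^ n / fact n)"
  note has_sum_cmult_right[OF has_sum_imaginary_powers_Im
      [OF hypergeo_double_series_imaginary[OF \<delta> dom, of "\<alpha> - 1" \<beta>]], of "1 / ((\<alpha> - 1) * \<tau>)"]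
  also have "(\<lambda>p. 1 / ((\<alpha> - 1) * \<tau>) * (case p of (k, n) \<Rightarrow> pochhammer (\<alpha> - 1) (n + Suc (2 * k)) * pochhammer \<beta> n
       / (pochhammer \<delta> n * fact n * fact (Suc (2 * k))) * y ^ n * (- (\<tau>\<^sup>2)) ^ k * \<tau>)) = ?f"
  proof (rule ext, clarify)
    fix k n :: nat
    have "(- (\<tau>\<^sup>2)) ^ k / fact (Suc (2 * k)) = (- x) ^ k / (fact k * pochhammer (3 / 2) k)"
      using power_mult_distrib[of 4 "- x" k] unfolding fact_Suc_double x by simp
    moreover have "pochhammer (\<alpha> - 1) (n + Suc (2 * k)) = (\<alpha> - 1) * pochhammer \<alpha> (2 * k + n)"
      using pochhammer_rec[of "\<alpha> - 1" "2 * k + n"] by (simp add: add.commute)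
    then have "1 / ((\<alpha> - 1) * \<tau>) * (pochhammer (\<alpha> - 1) (n + Suc (2 * k)) * pochhammer \<beta> n
       / (pochhammer \<delta> n * fact n * fact (Suc (2 * k))) * y ^ n * (- (\<tau>\<^sup>2)) ^ k * \<tau>) =
       pochhammer \<alpha> (2 * k + n) * pochhammer \<beta> n / (pochhammer \<delta> n * fact n) * y ^ n *
         ((- (\<tau>\<^sup>2)) ^ k / fact (Suc (2 * k)))"
      using \<alpha> \<tau> by (simp del: fact_Suc add: mult_ac)
    ultimately show "1 / ((\<alpha> - 1) * \<tau>) * (pochhammer (\<alpha> - 1) (n + Suc (2 * k)) * pochhammer \<beta> n
       / (pochhammer \<delta> n * fact n * fact (Suc (2 * k))) * y ^ n * (- (\<tau>\<^sup>2)) ^ k * \<tau>) =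
       pochhammer \<alpha> (2 * k + n) * pochhammer \<beta> n
       / (pochhammer (3 / 2) k * pochhammer \<delta> n) * ((- x) ^ k / fact k) * (y ^ n / fact n)"
      by (simp add: mult_ac)
  qed
  finally have "(?f has_sum 1 / ((\<alpha> - 1) * \<tau>) * - Im ?S) UNIV" .
  from suminf_suminf_eq_of_has_sum[OF this] show ?thesis
    unfolding horn_H4_series_def prod.case by (simp only: divide_minus_left mult_minus_left mult_minus_right)
qed

section \<open>Continuation beyond the domain of convergence\<close>

text \<open>The square root is the complex one, in order that \<open>1 + 2 i \<sigma> \<surd>x\<close> be a holomorphic function of \<open>x\<close>
near the positive axis.\<close>

definition horn_base :: "real \<Rightarrow> complex \<Rightarrow> complex" where
  "horn_base \<sigma> z = 1 + of_real \<sigma> * 2 * \<i> * csqrt z"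

lemma horn_base_of_real: "0 \<le> x \<Longrightarrow> horn_base \<sigma> (of_real x) = 1 + of_real \<sigma> * 2 * \<i> * of_real (sqrt x)"
  by (simp add: horn_base_def)

text \<open>Away from the cut the principal square root has nonzero real part; multiplication by \<open>2 i \<sigma>\<close> turns
it into a nonzero imaginary part. Hence neither the power nor the Gauss function of \<open>y / \<xi>\<close> ever meets its cut.\<close>

lemma horn_base_notin_Reals:
  assumes z: "z \<notin> \<real>\<^sub>\<le>\<^sub>0" and \<sigma>: "\<sigma> \<noteq> 0"
  shows "horn_base \<sigma> z \<notin> \<real>"
proof -
  have "Re (csqrt z) \<noteq> 0"
  proof
    assume "Re (csqrt z) = 0"
    then have "csqrt z = \<i> * of_real (Im (csqrt z))" by (simp add: complex_eq_iff)
    then have "z = (\<i> * of_real (Im (csqrt z))) ^ 2" by (metis power2_csqrt)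
    also have "\<dots> = of_real (- ((Im (csqrt z))\<^sup>2))" by (simp add: power_mult_distrib)
    finally have "z \<in> \<real>\<^sub>\<le>\<^sub>0" by (metis nonpos_Reals_of_real_iff neg_le_0_iff_le zero_le_power2)
    with z show False by simp
  qed
  then show ?thesis using \<sigma> by (simp add: horn_base_def complex_is_Real_iff)
qed

lemma horn_base_notin_nonpos_Reals: "z \<notin> \<real>\<^sub>\<le>\<^sub>0 \<Longrightarrow> \<sigma> \<noteq> 0 \<Longrightarrow> horn_base \<sigma> z \<notin> \<real>\<^sub>\<le>\<^sub>0"
  using horn_base_notin_Reals nonpos_Reals_subset_Reals by blast

lemma holomorphic_horn_base [holomorphic_intros]: "horn_base \<sigma> holomorphic_on - \<real>\<^sub>\<le>\<^sub>0"
  unfolding horn_base_def[abs_def] by (intro holomorphic_intros) auto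

lemma divide_in_slit_plane:
  assumes "\<xi> \<notin> \<real>"
  shows "of_real y / \<xi> \<in> slit_plane"
proof
  assume "of_real y / \<xi> \<in> complex_of_real ` {1..}"
  then obtain s where s: "of_real y / \<xi> = of_real s" "1 \<le> s" by auto
  moreover have "\<xi> \<noteq> 0" using assms by auto
  ultimately have "\<xi> = of_real (y / s)" by (auto simp: field_simps)
  with assms show False by simp
qed

text \<open>The step common to both formulas: an identity in the domain of convergence extends to all \<open>x > 0\<close>,
as its right-hand side is a real-analytic continuation, and there is only one.\<close>

lemma horn_H4_eq_Re:
  fixes a b c :: complex
  assumes \<Phi>: "hyp2F1_continuation a b c \<Phi>" and \<sigma>: "\<sigma> \<noteq> 0"
    and g: "g holomorphic_on - \<real>\<^sub>\<le>\<^sub>0"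
    and series: "\<And>x y. 0 < x \<Longrightarrow> 2 * sqrt x + \<bar>y\<bar> < 1 \<Longrightarrow>
      horn_H4_series \<alpha> \<beta> \<gamma> \<delta> (- x) y =
        Re (g (of_real x) * eval_fps (fps_hypergeo [a, b] [c] 1) (of_real y / horn_base \<sigma> (of_real x)))"
    and x: "0 < x"
  shows "horn_H4 \<alpha> \<beta> \<gamma> \<delta> (- x) y = Re (g (of_real x) * hyp2F1 a b c (of_real y / horn_base \<sigma> (of_real x)))"
proof -
  define F where "F = (\<lambda>x y. Re (g (of_real x) * \<Phi> (inverse (horn_base \<sigma> (of_real x)) * of_real y)))"
  have slit: "of_real y / horn_base \<sigma> (of_real x) \<in> slit_plane" if "0 < x" for x y
    using horn_base_notin_Reals[of "of_real x" \<sigma>] that \<sigma>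
    by (intro divide_in_slit_plane) auto
  have nz: "horn_base \<sigma> z \<noteq> 0" if "z \<in> - \<real>\<^sub>\<le>\<^sub>0" for z
    using horn_base_notin_Reals[of z \<sigma>] that \<sigma> by auto
  have "horn_H4_continuation \<alpha> \<beta> \<gamma> \<delta> F"
    unfolding horn_H4_continuation_def
  proof (intro conjI allI impI)
    show "real_analytic2_on F ({0<..} \<times> UNIV)"
      unfolding F_def
    proof (rule real_analytic2_on_Re[OF g, where B = slit_plane])
      show "(\<lambda>z. inverse (horn_base \<sigma> z)) holomorphic_on - \<real>\<^sub>\<le>\<^sub>0"
        using nz by (intro holomorphic_intros) auto
      show "\<Phi> holomorphic_on slit_plane" using \<Phi> by (simp add: hyp2F1_continuation_def)
      show "of_real x \<in> - \<real>\<^sub>\<le>\<^sub>0 \<and> inverse (horn_base \<sigma> (of_real x)) * of_real y \<in> slit_plane"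
        if "(x, y) \<in> {0<..} \<times> UNIV" for x y
        using that slit[of x y] by (auto simp: field_simps)
    qed (use open_slit_plane in auto)
  next
    fix x y :: real assume xy: "0 < x" "2 * sqrt x + \<bar>y\<bar> < 1"
    have "1 \<le> norm (horn_base \<sigma> (of_real x))"
      using complex_Re_le_cmod[of "horn_base \<sigma> (of_real x)"] xy by (simp add: horn_base_of_real)
    moreover have "\<bar>y\<bar> < 1" using xy real_sqrt_gt_zero[of x] by linarith
    ultimately have "norm (of_real y / horn_base \<sigma> (of_real x)) < 1"
      by (simp add: norm_divide divide_simps)
    then show "F x y = horn_H4_series \<alpha> \<beta> \<gamma> \<delta> (- x) y"
      using \<Phi> series[OF xy] by (simp add: F_def hyp2F1_continuation_def field_simps)
  qed
  then have "horn_H4 \<alpha> \<beta> \<gamma> \<delta> (- x) y = F x y" using x by (rule horn_H4_eqI)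
  then show ?thesis
    using hyp2F1_eqI[OF \<Phi> slit[OF x, of y]] by (simp add: F_def field_simps)
qed

theorem proposition5:
  fixes \<alpha> \<beta> \<delta> x y \<sigma> :: real
  assumes "\<delta> \<notin> \<int>\<^sub>\<le>\<^sub>0" and "x > 0" and "\<sigma> \<in> {1, -1}"
  shows "horn_H4 \<alpha> \<beta> (1/2) \<delta> (- x) y =
           Re ((1 + of_real \<sigma> * 2 * \<i> * of_real (sqrt x)) powr (- of_real \<alpha>) *
               hyp2F1 (of_real \<alpha>) (of_real \<beta>) (of_real \<delta>)
                 (of_real y / (1 + of_real \<sigma> * 2 * \<i> * of_real (sqrt x))))
         \<and>
         (\<alpha> \<noteq> 1 \<longrightarrow>
         horn_H4 \<alpha> \<beta> (3/2) \<delta> (- x) y =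
           - \<sigma> / (2 * (\<alpha> - 1) * sqrt x) *
           Im ((1 + of_real \<sigma> * 2 * \<i> * of_real (sqrt x)) powr (1 - of_real \<alpha>) *
               hyp2F1 (of_real \<alpha> - 1) (of_real \<beta>) (of_real \<delta>)
                 (of_real y / (1 + of_real \<sigma> * 2 * \<i> * of_real (sqrt x)))))"
proof -
  have \<sigma>: "\<sigma> \<noteq> 0" "\<bar>\<sigma>\<bar> = 1" "\<sigma>\<^sup>2 = 1" using assms(3) by auto
  define \<tau> where "\<tau> = (\<lambda>x. 2 * \<sigma> * sqrt x)"
  have base: "horn_base \<sigma> (of_real x) = 1 + \<i> * of_real (\<tau> x)" if "0 < x" for x
    using that by (simp add: horn_base_of_real \<tau>_def)
  have \<tau>: "\<bar>\<tau> x\<bar> = 2 * sqrt x" "(\<tau> x)\<^sup>2 = 4 * x" "\<tau> x \<noteq> 0" if "0 < x" for x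
    using that \<sigma> by (auto simp: \<tau>_def abs_mult power_mult_distrib)
  have powr_hol: "(\<lambda>z. horn_base \<sigma> z powr p) holomorphic_on - \<real>\<^sub>\<le>\<^sub>0" for p
    using horn_base_notin_nonpos_Reals \<sigma> by (intro holomorphic_intros) auto
  show ?thesis
  proof (intro conjI impI)
    obtain \<Phi> where \<Phi>: "hyp2F1_continuation (of_real \<alpha>) (of_real \<beta>) (of_real \<delta>) \<Phi>"
      using hyp2F1_continuation_exists[OF assms(1)] by blast
    have "horn_H4 \<alpha> \<beta> (1/2) \<delta> (- x) y = Re (horn_base \<sigma> (of_real x) powr (- of_real \<alpha>) *
        hyp2F1 (of_real \<alpha>) (of_real \<beta>) (of_real \<delta>) (of_real y / horn_base \<sigma> (of_real x)))"
    proof (rule horn_H4_eq_Re[OF \<Phi> \<sigma>(1) powr_hol _ assms(2)])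
      fix x y :: real assume xy: "0 < x" "2 * sqrt x + \<bar>y\<bar> < 1"
      show "horn_H4_series \<alpha> \<beta> (1/2) \<delta> (- x) y = Re (horn_base \<sigma> (of_real x) powr (- of_real \<alpha>) *
          eval_fps (fps_hypergeo [of_real \<alpha>, of_real \<beta>] [of_real \<delta>] 1) (of_real y / horn_base \<sigma> (of_real x)))"
        unfolding base[OF xy(1)]
        by (rule horn_H4_series_half[OF assms(1) _ \<tau>(2)[OF xy(1)]]) (use \<tau>(1) xy in auto)
    qed
    then show "horn_H4 \<alpha> \<beta> (1/2) \<delta> (- x) y =
           Re ((1 + of_real \<sigma> * 2 * \<i> * of_real (sqrt x)) powr (- of_real \<alpha>) *
               hyp2F1 (of_real \<alpha>) (of_real \<beta>) (of_real \<delta>)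
                 (of_real y / (1 + of_real \<sigma> * 2 * \<i> * of_real (sqrt x))))"
      using assms(2) by (simp only: horn_base_of_real less_imp_le)
  next
    assume \<alpha>: "\<alpha> \<noteq> 1"
    obtain \<Phi> where \<Phi>: "hyp2F1_continuation (of_real (\<alpha> - 1)) (of_real \<beta>) (of_real \<delta>) \<Phi>"
      using hyp2F1_continuation_exists[OF assms(1)] by blast
    \<comment> \<open>The real part of \<open>i r w\<close> is \<open>- r Im w\<close> for real \<open>r\<close>, which brings the second formula into the form of the first.\<close>
    define g where "g = (\<lambda>z. \<i> / (of_real (2 * \<sigma> * (\<alpha> - 1)) * csqrt z) * horn_base \<sigma> z powr (- of_real (\<alpha> - 1)))"
    have csqrt_nz: "csqrt z \<noteq> 0" if "z \<in> - \<real>\<^sub>\<le>\<^sub>0" for z using that by auto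
    have g: "g holomorphic_on - \<real>\<^sub>\<le>\<^sub>0"
      unfolding g_def using csqrt_nz \<sigma> \<alpha> by (intro holomorphic_intros powr_hol) auto
    have Re_g: "Re (g (of_real x) * w) = - 1 / ((\<alpha> - 1) * \<tau> x) * Im (horn_base \<sigma> (of_real x) powr (- of_real (\<alpha> - 1)) * w)"
      if "0 < x" for x w
    proof -
      have "g (of_real x) * w = \<i> * of_real (1 / ((\<alpha> - 1) * \<tau> x)) *
          (horn_base \<sigma> (of_real x) powr (- of_real (\<alpha> - 1)) * w)"
        using that by (simp add: g_def \<tau>_def mult_ac)
      moreover have "Re (\<i> * of_real r * v) = - r * Im v" for r v by simp
      ultimately show ?thesis by (metis minus_divide_left)
    qed
    have "horn_H4 \<alpha> \<beta> (3/2) \<delta> (- x) y = Re (g (of_real x) *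
        hyp2F1 (of_real (\<alpha> - 1)) (of_real \<beta>) (of_real \<delta>) (of_real y / horn_base \<sigma> (of_real x)))"
    proof (rule horn_H4_eq_Re[OF \<Phi> \<sigma>(1) g _ assms(2)])
      fix x y :: real assume xy: "0 < x" "2 * sqrt x + \<bar>y\<bar> < 1"
      show "horn_H4_series \<alpha> \<beta> (3/2) \<delta> (- x) y = Re (g (of_real x) *
          eval_fps (fps_hypergeo [of_real (\<alpha> - 1), of_real \<beta>] [of_real \<delta>] 1) (of_real y / horn_base \<sigma> (of_real x)))"
        unfolding Re_g[OF xy(1)] base[OF xy(1)]
        by (rule horn_H4_series_three_halves[OF assms(1) _ \<tau>(2)[OF xy(1)] \<tau>(3)[OF xy(1)] \<alpha>])
           (use \<tau>(1) xy in auto)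
    qed
    moreover have "- 1 / ((\<alpha> - 1) * \<tau> x) = - \<sigma> / (2 * (\<alpha> - 1) * sqrt x)"
      using assms(3) by (auto simp: \<tau>_def)
    ultimately show "horn_H4 \<alpha> \<beta> (3/2) \<delta> (- x) y =
           - \<sigma> / (2 * (\<alpha> - 1) * sqrt x) *
           Im ((1 + of_real \<sigma> * 2 * \<i> * of_real (sqrt x)) powr (1 - of_real \<alpha>) *
               hyp2F1 (of_real \<alpha> - 1) (of_real \<beta>) (of_real \<delta>)
                 (of_real y / (1 + of_real \<sigma> * 2 * \<i> * of_real (sqrt x))))"
      using assms(2)
      by (simp only: Re_g horn_base_of_real less_imp_le of_real_diff of_real_1 minus_diff_eq)
  qed
qed

end
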